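(* Let $R$ be a ring (not necessarily with $1$), let $G$ be a finite subgroup of $\mathrm{Aut}(R)$ and $n=|G|$. Let $\mathcal{B}(R,G)$ be the set of bad primes, and suppose that $\mathcal{B}(R,G)\neq\emptyset$ and that for each $p\in\mathcal{B}(R,G)$: 1. the group $G$ has a $p$-normal complement $N(p)$; 2. the ring $R^G$ is $p$-torsion free; 3. $t_{G(p)}(R^{N(p)})^{d(p)}=0$ for some natural number $d(p)\geq 1$, where $G(p):=G/N(p)$ and $t_{G(p)}: R^{N(p)}\to (R^{N(p)})^{G(p)}=R^G$, $r\mapsto\sum_{\sigma\in G(p)}r^{\sigma}$. Then: 1. $R^l=0$ where $l=\max_{p\in\mathcal{B}(R,G)}\{l(p)\}$ and $l(p):=h(N(p))^{h(G(p))^{d(p)}}$. In particular, the ring $R$ is nilpotent. 2. For every prime $p\in\mathcal{B}(R,G)$, the ring $R^{N(p)}$ is a $p$-torsion free, nilpotent ring. Furthermore, $(R^{N(p)})^{m(p)}=0$ where $m(p)=h(G(p))^{d(p)}$.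
   Context: Rings are associative and need not have an identity. $\mathrm{Aut}(R)$ is the group of ring automorphisms of $R$; the action of $\sigma\in\mathrm{Aut}(R)$ on $r\in R$ is written $\sigma(r)$ or $r^\sigma$. For a subgroup $H$ of $\mathrm{Aut}(R)$, $R^H=\{r\in R : r^g=r \text{ for all } g\in H\}$ is the ring of $H$-invariants. For a natural number $k\ge 1$, $\mathrm{tor}_k(R)=\{r\in R : k^i r=0\text{ for some } i\geq 1\}$, and $R$ is called $k$-torsion free if $\mathrm{tor}_k(R)=0$. The set of bad primes $\mathcal{B}(R,G)$ is the set of primes $p$ such that $p$ divides $|G|$ and $\mathrm{tor}_p(R)\neq 0$. If $p$ is a prime dividing $|G|$ and $|G|=p^s m$ with $s\geq 1$ and $p\nmid m$, a $p$-normal complement of $G$ is a normal subgroup $N(p)$ of $G$ of order $m$ (it is unique if it exists). For a normal subgroup $N$ of $G$, the factor group $G/N$ acts on $R^N$ and $(R^N)^{G/N}=R^G$. For a finite group $H$, $h(H)=\prod_{i=1}^{|H|}\left(\binom{|H|}{i}+1\right)$. For a subset $X$ of a ring, $X^d=0$ means that every product of $d$ elements of $X$ is zero. *)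

theory Defs
  imports "HOL-Algebra.Coset" "HOL-Computational_Algebra.Primes"
begin

text \<open>
  The ring \<open>R\<close> is the universe of a type of class \<^class>\<open>ring\<close>. This class requires an associative
  multiplication but no identity. Groups are those of HOL-Algebra.
\<close>

definition ring_Aut :: "('a::ring \<Rightarrow> 'a) monoid" where
  "ring_Aut = \<lparr>carrier = {f. bij f \<and> (\<forall>x y. f (x + y) = f x + f y) \<and> (\<forall>x y. f (x * y) = f x * f y)},
               monoid.mult = (\<circ>), one = id\<rparr>"

abbreviation Aut_subgroup :: "('a::ring \<Rightarrow> 'a) set \<Rightarrow> ('a \<Rightarrow> 'a) monoid" where
  "Aut_subgroup H \<equiv> ring_Aut\<lparr>carrier := H\<rparr>"

definition invariants :: "('a::ring \<Rightarrow> 'a) set \<Rightarrow> 'a set" where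
  "invariants H = {r. \<forall>g\<in>H. g r = r}"

text \<open>
  The multiple \<open>k r\<close> is written as a \<open>k\<close>-fold sum, since a ring without identity does not contain
  the image of \<open>k\<close>.
\<close>

definition nat_multiple :: "nat \<Rightarrow> 'a::ring \<Rightarrow> 'a" where
  "nat_multiple k r = (\<Sum>_\<in>{..<k}. r)"

definition tor :: "nat \<Rightarrow> 'a::ring set \<Rightarrow> 'a set" where
  "tor k S = {r \<in> S. \<exists>i\<ge>1. nat_multiple (k ^ i) r = 0}"

definition torsion_free :: "nat \<Rightarrow> 'a::ring set \<Rightarrow> bool" where
  "torsion_free k S \<longleftrightarrow> tor k S = {0}"

definition bad_primes :: "('a::ring \<Rightarrow> 'a) set \<Rightarrow> nat set" where
  "bad_primes G = {p. prime p \<and> p dvd card G \<and> tor p (UNIV :: 'a set) \<noteq> {0}}"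

definition normal_complement :: "nat \<Rightarrow> 'g set \<Rightarrow> ('g, 'x) monoid_scheme \<Rightarrow> bool" where
  "normal_complement p N H \<longleftrightarrow>
     N \<lhd> H \<and> (\<exists>s m. s \<ge> 1 \<and> \<not> p dvd m \<and> order H = p ^ s * m \<and> card N = m)"

definition h_bound :: "('g, 'x) monoid_scheme \<Rightarrow> nat" where
  "h_bound H = (\<Prod>i=1..order H. (order H choose i) + 1)"

text \<open>
  A coset of \<open>N\<close> acts on an \<open>N\<close>-invariant element by the common value of its representatives; see
  \<open>coset_act_eq\<close> below.
\<close>

definition coset_act :: "('a::ring \<Rightarrow> 'a) set \<Rightarrow> 'a \<Rightarrow> 'a" where
  "coset_act C r = the_elem ((\<lambda>\<sigma>. \<sigma> r) ` C)"

definition quotient_trace :: "('a::ring \<Rightarrow> 'a) set \<Rightarrow> ('a \<Rightarrow> 'a) set \<Rightarrow> 'a \<Rightarrow> 'a" where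
  "quotient_trace G N r = (\<Sum>C\<in>carrier (Aut_subgroup G Mod N). coset_act C r)"

text \<open>
  \<open>power_zero X d\<close> is \<open>X\<^sup>d = 0\<close>. It is meant for \<open>d \<ge> 1\<close> only, as the empty product does not exist,
  and is false for \<open>d = 0\<close>.
\<close>

definition power_zero :: "'a::ring set \<Rightarrow> nat \<Rightarrow> bool" where
  "power_zero X d \<longleftrightarrow>
     d \<ge> 1 \<and> (\<forall>x xs. set (x # xs) \<subseteq> X \<and> length (x # xs) = d \<longrightarrow> foldl (*) x xs = 0)"

definition nilpotent :: "'a::ring set \<Rightarrow> bool" where
  "nilpotent S \<longleftrightarrow> (\<exists>d. power_zero S d)"

lemma group_ring_Aut: "group (ring_Aut :: ('a::ring \<Rightarrow> 'a) monoid)"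
proof (rule groupI)
  fix f :: "'a \<Rightarrow> 'a" assume "f \<in> carrier ring_Aut"
  then have f: "bij f" "\<And>x y. f (x + y) = f x + f y" "\<And>x y. f (x * y) = f x * f y"
    by (auto simp: ring_Aut_def)
  have "inv_into UNIV f (x + y) = inv_into UNIV f x + inv_into UNIV f y"
    "inv_into UNIV f (x * y) = inv_into UNIV f x * inv_into UNIV f y" for x y
    using f by (metis bij_inv_eq_iff)+
  then have "inv_into UNIV f \<in> carrier ring_Aut"
    using f(1) by (simp add: ring_Aut_def bij_imp_bij_inv)
  moreover have "inv_into UNIV f \<circ> f = id"
    using f(1) by (simp add: bij_is_inj)
  ultimately show "\<exists>g\<in>carrier ring_Aut. g \<otimes>\<^bsub>ring_Aut\<^esub> f = \<one>\<^bsub>ring_Aut\<^esub>"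
    by (auto simp: ring_Aut_def)
qed (auto simp: ring_Aut_def bij_comp comp_assoc)

lemma coset_act_eq:
  fixes G N :: "('a::ring \<Rightarrow> 'a) set"
  assumes "N \<lhd> Aut_subgroup G" "C \<in> carrier (Aut_subgroup G Mod N)" "\<sigma> \<in> C" "r \<in> invariants N"
  shows "coset_act C r = \<sigma> r"
proof -
  interpret N: normal N "Aut_subgroup G" by (rule assms(1))
  obtain g where g: "g \<in> G" "C = N #>\<^bsub>Aut_subgroup G\<^esub> g"
    using assms(2) by (auto simp: FactGroup_def RCOSETS_def)
  have C: "C = g <#\<^bsub>Aut_subgroup G\<^esub> N"
    using g N.coset_eq by auto
  have "\<tau> r = g r" if "\<tau> \<in> C" for \<tau>
    using that assms(4) unfolding C by (auto simp: l_coset_def ring_Aut_def invariants_def)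
  then have "\<tau> r = \<sigma> r" if "\<tau> \<in> C" for \<tau>
    using that assms(3) by metis
  then have "(\<lambda>\<tau>. \<tau> r) ` C = (\<lambda>\<tau>. \<sigma> r) ` C"
    by (rule image_cong[OF refl])
  also have "\<dots> = {\<sigma> r}"
    using assms(3) by auto
  finally show ?thesis by (simp add: coset_act_def)
qed

end

theory Submission
  imports Defs "HOL-Algebra.Multiplicative_Group"
begin

text \<open>
  The core is the theorem of Bergman and Isaacs with its explicit exponent. Let \<open>\<sigma>\<^sub>h\<close> (\<open>h \<in> \<Gamma>\<close>) be \<open>n\<close>
  surjective endomorphisms of a ring \<open>A\<close>, and call sums of functions \<open>h \<mapsto> a \<sigma>\<^sub>h(b)\<close> twisted. The
  sum over \<open>\<Gamma>\<close> of a twisted function lies in the ideal \<open>I\<close> of the traces. For \<open>\<Lambda> \<subseteq> \<Gamma>\<close> let \<open>P\<^sub>\<Lambda>\<close> be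
  the ideal of all \<open>c\<close> such that, for every \<open>g \<in> \<Lambda>\<close>, some twisted function has the value \<open>c\<close> at \<open>g\<close> and
  vanishes on the rest of \<open>\<Lambda>\<close>. By Lagrange interpolation some twisted \<open>f\<close> equals \<open>c\<close> on \<open>\<Lambda>\<close>, and
  summing the error \<open>c - f\<close> over \<open>\<Gamma>\<close> shows that \<open>n P\<^sub>\<Lambda> P\<^sub>\<Lambda>\<close> is contained in the sum of \<open>I\<close> and the
  ideals of the sets \<open>\<Lambda> \<union> {h}\<close>, \<open>h \<notin> \<Lambda>\<close>. A product of \<open>(n choose m) + 1\<close> factors from ideals \<open>P\<^sub>\<Lambda>\<close>
  with \<open>|\<Lambda>| = m\<close> repeats some \<open>\<Lambda>\<close>, so it moves one step up; at \<open>\<Lambda> = \<Gamma>\<close> only \<open>I\<close> is left. All this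
  holds up to multiplication by powers of \<open>n\<close>. Iterating along the right ideals \<open>T\<^sup>j A\<close>, with \<open>T\<close> the
  set of traces, gives the exponent \<open>h(n)\<^sup>d\<close> if \<open>T\<^sup>d = 0\<close>.

  For a bad prime \<open>p\<close>, the \<open>p\<close>-group \<open>G/N(p)\<close> would fix a nonzero element of \<open>p\<close>-torsion if
  \<open>R\<^bsup>N(p)\<^esup>\<close> had any, so \<open>R\<^bsup>N(p)\<^esup>\<close> is \<open>p\<close>-torsion free and the theorem applies to it. It then applies to
  \<open>N(p)\<close> acting on \<open>R\<close>, so that every product of \<open>l\<close> elements is annihilated by a power of \<open>|N(p)|\<close>,
  for each bad \<open>p\<close>. If such a product were nonzero, a prime divisor of its additive order would divide
  all \<open>|N(p)|\<close>, hence would be bad itself, a contradiction.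
\<close>

section \<open>Multiples, products and pure closures\<close>

lemma nat_multiple_0 [simp]: "nat_multiple 0 x = 0"
  and nat_multiple_Suc: "nat_multiple (Suc k) x = nat_multiple k x + x"
  and nat_multiple_1 [simp]: "nat_multiple (Suc 0) x = x"
  and nat_multiple_zero [simp]: "nat_multiple k 0 = 0"
  by (simp_all add: nat_multiple_def)

lemma nat_multiple_add: "nat_multiple (k + l) x = nat_multiple k x + nat_multiple l x"
  by (induction l) (simp_all add: nat_multiple_Suc add.assoc)

lemma nat_multiple_mult: "nat_multiple (k * l) x = nat_multiple k (nat_multiple l x)"
  by (induction k) (simp_all add: nat_multiple_Suc nat_multiple_add add.commute)

lemma nat_multiple_diff_right: "nat_multiple k (x - y) = nat_multiple k x - nat_multiple k y"
  by (simp add: nat_multiple_def sum_subtractf)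

lemma nat_multiple_add_right: "nat_multiple k (x + y) = nat_multiple k x + nat_multiple k y"
  by (simp add: nat_multiple_def sum.distrib)

lemma mult_nat_multiple_left: "nat_multiple k x * y = nat_multiple k (x * y)"
  by (simp add: nat_multiple_def sum_distrib_right)

lemma sum_const_eq_nat_multiple: "finite B \<Longrightarrow> (\<Sum>_\<in>B. x) = nat_multiple (card B) x"
  by (induction B rule: finite_induct) (simp_all add: nat_multiple_Suc add.commute)

lemma additive_nat_multiple: "additive f \<Longrightarrow> f (nat_multiple k x) = nat_multiple k (f x)"
  by (simp add: nat_multiple_def additive.sum)

section \<open>Products of nonempty lists\<close>

fun list_product :: "'a::semigroup_mult list \<Rightarrow> 'a" where
  "list_product [x] = x"
| "list_product (x # y # zs) = x * list_product (y # zs)"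

lemma list_product_Cons: "ys \<noteq> [] \<Longrightarrow> list_product (y # ys) = y * list_product ys"
  by (cases ys) auto

lemma list_product_append:
  "xs \<noteq> [] \<Longrightarrow> ys \<noteq> [] \<Longrightarrow> list_product (xs @ ys) = list_product xs * list_product ys"
  by (induction xs rule: list_product.induct) (auto simp: list_product_Cons mult.assoc)

lemma foldl_mult_eq_list_product: "foldl (*) x xs = list_product (x # xs)"
proof (induction xs arbitrary: x)
  case (Cons y ys)
  show ?case
    using Cons.IH[of "x * y"] by (cases ys) (simp_all add: mult.assoc)
qed simp

text \<open>The relation \<open>X^k \<subseteq> Y\<close> with an arbitrary target, so that
  exponents multiply along a chain of sets. It is meant for \<open>k \<ge> 1\<close>, since
  \<open>list_product []\<close> has no specified value.\<close>

definition products_in :: "'a::semigroup_mult set \<Rightarrow> nat \<Rightarrow> 'a set \<Rightarrow> bool" where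
  "products_in X k Y \<longleftrightarrow> (\<forall>xs. set xs \<subseteq> X \<and> length xs = k \<longrightarrow> list_product xs \<in> Y)"

lemma products_inD: "products_in X k Y \<Longrightarrow> set xs \<subseteq> X \<Longrightarrow> length xs = k \<Longrightarrow> list_product xs \<in> Y"
  by (simp add: products_in_def)

lemma power_zero_iff: "power_zero X k \<longleftrightarrow> k \<ge> 1 \<and> products_in X k {0}"
  unfolding power_zero_def products_in_def foldl_mult_eq_list_product
  by (metis One_nat_def length_0_conv list.exhaust not_one_le_zero singleton_iff)

lemma products_in_mono: "products_in X k Y \<Longrightarrow> X' \<subseteq> X \<Longrightarrow> Y \<subseteq> Y' \<Longrightarrow> products_in X' k Y'"
  unfolding products_in_def by blast

lemma products_in_1: "products_in X (Suc 0) Y \<longleftrightarrow> X \<subseteq> Y"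
  by (force simp: products_in_def length_Suc_conv)

text \<open>Cut the product into \<open>l\<close> blocks of length \<open>k\<close>: each block lies
  in \<open>Y\<close>.\<close>

lemma products_in_trans:
  assumes "k \<ge> 1" "l \<ge> 1" "products_in X k Y" "products_in Y l Z"
  shows "products_in X (k * l) Z"
proof -
  have "\<exists>ys. set ys \<subseteq> Y \<and> length ys = l \<and> list_product ys = list_product xs"
    if "set xs \<subseteq> X" "length xs = k * l" for xs
    using \<open>l \<ge> 1\<close> that
  proof (induction l arbitrary: xs rule: nat_induct_at_least)
    case base
    then show ?case
      using assms(3) by (intro exI[of _ "[list_product xs]"]) (auto simp: products_in_def)
  next
    case (Suc l)
    let ?us = "take k xs" and ?vs = "drop k xs"
    have "set ?us \<subseteq> X" "set ?vs \<subseteq> X"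
      using Suc.prems(1) set_take_subset[of k xs] set_drop_subset[of k xs] by auto
    moreover have "length ?us = k" "length ?vs = k * l"
      using Suc.prems(2) by simp_all
    ultimately obtain ys where ys: "set ys \<subseteq> Y" "length ys = l" "list_product ys = list_product ?vs"
      using Suc.IH by blast
    have "list_product ?us \<in> Y"
      using assms(3) \<open>set ?us \<subseteq> X\<close> \<open>length ?us = k\<close> by (rule products_inD)
    moreover have "list_product (?us @ ?vs) = list_product ?us * list_product ?vs"
      using Suc.hyps assms(1) Suc.prems(2) by (intro list_product_append) auto
    then have "list_product xs = list_product (list_product ?us # ys)"
      using ys Suc.hyps by (subst list_product_Cons) auto
    ultimately show ?case
      using ys by (intro exI[of _ "list_product ?us # ys"]) auto
  qed
  then show ?thesis
    using assms(4) unfolding products_in_def by metis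
qed

text \<open>The first \<open>k\<close> factors already land in \<open>Y\<close>, which absorbs the
  others from the right. This raises the exponents of the single bad primes to their
  maximum.\<close>

lemma products_in_zero_mono:
  fixes X :: "'a::ring set"
  assumes "\<And>x y. x \<in> Y \<Longrightarrow> x * y \<in> Y" "k \<ge> 1" "products_in X k Y" "k \<le> l"
  shows "products_in X l Y"
  unfolding products_in_def
proof (intro allI impI, elim conjE)
  fix xs assume xs: "set xs \<subseteq> X" "length xs = l"
  have "list_product (take k xs) \<in> Y"
    using assms xs set_take_subset[of k xs] by (intro products_inD[OF assms(3)]) auto
  moreover have "list_product xs = list_product (take k xs) * list_product (drop k xs)" if "k < l"
    using list_product_append[of "take k xs" "drop k xs"] that assms(2) xs by fastforce
  ultimately show "list_product xs \<in> Y"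
    using assms(1,4) xs(2) by (cases "k < l") auto
qed

text \<open>For \<open>k = 1\<close> this is the additive subgroup generated by \<open>X\<close>.\<close>

inductive_set pure_closure :: "nat \<Rightarrow> 'a::ring set \<Rightarrow> 'a set" for k X where
  zero: "0 \<in> pure_closure k X"
| base: "x \<in> X \<Longrightarrow> x \<in> pure_closure k X"
| diff: "x \<in> pure_closure k X \<Longrightarrow> y \<in> pure_closure k X \<Longrightarrow> x - y \<in> pure_closure k X"
| root: "nat_multiple k x \<in> pure_closure k X \<Longrightarrow> x \<in> pure_closure k X"

lemma pure_closure_add:
  assumes "x \<in> pure_closure k X" "y \<in> pure_closure k X"
  shows "x + y \<in> pure_closure k X"
proof -
  have "x - (0 - y) \<in> pure_closure k X"
    using assms by (intro pure_closure.diff pure_closure.zero)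
  then show ?thesis by simp
qed

lemma pure_closure_sum:
  "(\<And>i. i \<in> B \<Longrightarrow> f i \<in> pure_closure k X) \<Longrightarrow> sum f B \<in> pure_closure k X"
  by (induction B rule: infinite_finite_induct) (auto intro: pure_closure.zero pure_closure_add)

text \<open>Additive maps commute with multiples, so roots carry over and only generators have to be
  checked.\<close>

lemma pure_closure_map:
  assumes "additive f" "\<And>x. x \<in> X \<Longrightarrow> f x \<in> pure_closure k Y" "x \<in> pure_closure k X"
  shows "f x \<in> pure_closure k Y"
  using assms(3)
proof induction
  case (root x)
  then show ?case
    using additive_nat_multiple[OF assms(1)] by (metis pure_closure.root)
qed (auto simp: assms additive.zero additive.diff intro: pure_closure.intros)

lemma pure_closure_minimal:
  assumes "x \<in> pure_closure k X" "X \<subseteq> Y" "0 \<in> Y"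
    "\<And>x y. x \<in> Y \<Longrightarrow> y \<in> Y \<Longrightarrow> x - y \<in> Y" "\<And>x. nat_multiple k x \<in> Y \<Longrightarrow> x \<in> Y"
  shows "x \<in> Y"
  using assms(1) by induction (use assms(2-) in auto)

text \<open>A difference adds the exponents, and a root costs one more.\<close>

lemma pure_closure_zero:
  assumes "x \<in> pure_closure k {0}"
  obtains e where "nat_multiple (k ^ e) x = 0"
proof -
  have "\<exists>e. nat_multiple (k ^ e) x = 0"
    using assms
  proof induction
    case (diff x y)
    then obtain a b where "nat_multiple (k ^ a) x = 0" "nat_multiple (k ^ b) y = 0" by blast
    then have "nat_multiple (k ^ b * k ^ a) x = 0" "nat_multiple (k ^ a * k ^ b) y = 0"
      by (simp_all add: nat_multiple_mult)
    then show ?case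
      by (intro exI[of _ "a + b"]) (simp add: nat_multiple_diff_right power_add mult.commute)
  next
    case (root x)
    then show ?case
      by (metis nat_multiple_mult power_Suc2)
  qed auto
  then show ?thesis using that by blast
qed

lemma additive_list_product: "additive (\<lambda>u::'a::ring. list_product (us @ u # xs))"
proof -
  have "additive (\<lambda>u::'a. list_product (u # xs))"
    by (cases xs) (auto simp: additive_def distrib_right)
  then show ?thesis
    by (induction us) (auto simp: additive_def list_product_Cons distrib_left)
qed

text \<open>A product is additive in each factor, so generators can be replaced by elements of the
  closure one at a time; \<open>us\<close> holds the replaced factors.\<close>

lemma products_in_pure_closure:
  assumes "products_in X l (pure_closure k Y)"
  shows "products_in (pure_closure k X) l (pure_closure k Y)"
proof -
  have "list_product (us @ xs) \<in> pure_closure k Y"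
    if "set us \<subseteq> pure_closure k X" "set xs \<subseteq> X" "length us + length xs = l" for us xs
    using that
  proof (induction us arbitrary: xs rule: rev_induct)
    case Nil
    then show ?case using assms by (simp add: products_in_def)
  next
    case (snoc u us)
    have "list_product (us @ u # xs) \<in> pure_closure k Y"
    proof (rule pure_closure_map[OF additive_list_product])
      show "u \<in> pure_closure k X" using snoc.prems by simp
      fix x assume "x \<in> X"
      then show "list_product (us @ x # xs) \<in> pure_closure k Y"
        using snoc.prems by (intro snoc.IH) auto
    qed
    then show ?case by simp
  qed
  from this[of _ "[]"] show ?thesis by (simp add: products_in_def)
qed

lemma not_distinct_map_decomp:
  "\<not> distinct (map f xs) \<Longrightarrow> \<exists>us p vs q ws. xs = us @ [p] @ vs @ [q] @ ws \<and> f p = f q"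
proof (induction xs)
  case (Cons x xs)
  show ?case
  proof (cases "f x \<in> f ` set xs")
    case True
    then obtain y vs ws where "f x = f y" "xs = vs @ y # ws"
      by (metis imageE split_list)
    then show ?thesis by (intro exI[of _ "[]"]) auto
  next
    case False
    then obtain us p vs q ws where "xs = us @ [p] @ vs @ [q] @ ws" "f p = f q"
      using Cons by auto
    then show ?thesis by (intro exI[of _ "x # us"]) auto
  qed
qed simp

section \<open>Families of surjective endomorphisms\<close>

text \<open>The carrier is a set because the family will live on rings of invariants and on the
  right ideals \<open>trace_power j\<close>. Surjectivity does the work of inverses: any element of
  \<open>A\<close> can be written as \<open>\<sigma> h z\<close>.\<close>

locale surjective_family =
  fixes A :: "'a::ring set" and \<Gamma> :: "'i set" and \<sigma> :: "'i \<Rightarrow> 'a \<Rightarrow> 'a"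
  assumes finite_index: "finite \<Gamma>"
    and zero_closed: "0 \<in> A"
    and diff_closed: "x \<in> A \<Longrightarrow> y \<in> A \<Longrightarrow> x - y \<in> A"
    and mult_closed: "x \<in> A \<Longrightarrow> y \<in> A \<Longrightarrow> x * y \<in> A"
    and hom_add: "h \<in> \<Gamma> \<Longrightarrow> x \<in> A \<Longrightarrow> y \<in> A \<Longrightarrow> \<sigma> h (x + y) = \<sigma> h x + \<sigma> h y"
    and hom_mult: "h \<in> \<Gamma> \<Longrightarrow> x \<in> A \<Longrightarrow> y \<in> A \<Longrightarrow> \<sigma> h (x * y) = \<sigma> h x * \<sigma> h y"
    and image_eq: "h \<in> \<Gamma> \<Longrightarrow> \<sigma> h ` A = A"
begin

lemma add_closed: "x \<in> A \<Longrightarrow> y \<in> A \<Longrightarrow> x + y \<in> A"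
  using diff_closed[OF _ diff_closed[OF zero_closed], of x y] by simp

lemma sum_closed: "(\<And>i. i \<in> B \<Longrightarrow> f i \<in> A) \<Longrightarrow> sum f B \<in> A"
  by (induction B rule: infinite_finite_induct) (auto intro: zero_closed add_closed)

lemma hom_closed: "h \<in> \<Gamma> \<Longrightarrow> x \<in> A \<Longrightarrow> \<sigma> h x \<in> A"
  using image_eq by blast

lemma hom_surj: "h \<in> \<Gamma> \<Longrightarrow> x \<in> A \<Longrightarrow> \<exists>y\<in>A. \<sigma> h y = x"
  using image_eq[of h] by (metis imageE)

lemma hom_diff: "h \<in> \<Gamma> \<Longrightarrow> x \<in> A \<Longrightarrow> y \<in> A \<Longrightarrow> \<sigma> h (x - y) = \<sigma> h x - \<sigma> h y"
  using hom_add[of h "x - y" y] diff_closed by (simp add: eq_diff_eq)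

lemma hom_zero: "h \<in> \<Gamma> \<Longrightarrow> \<sigma> h 0 = 0"
  using hom_diff[of h 0 0] zero_closed by simp

definition trace :: "'a \<Rightarrow> 'a" where
  "trace r = (\<Sum>h\<in>\<Gamma>. \<sigma> h r)"

lemma trace_closed: "r \<in> A \<Longrightarrow> trace r \<in> A"
  unfolding trace_def by (intro sum_closed hom_closed)

lemma trace_diff: "x \<in> A \<Longrightarrow> y \<in> A \<Longrightarrow> trace (x - y) = trace x - trace y"
  by (simp add: trace_def hom_diff sum_subtractf)

text \<open>
  Only the values on \<open>\<Gamma>\<close> matter: outside \<open>\<Gamma>\<close> the function \<open>\<sigma>\<close> is arbitrary. The rule \<open>agree\<close>
  discards the values there.
\<close>

inductive twisted :: "('i \<Rightarrow> 'a) \<Rightarrow> bool" where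
  hom: "b \<in> A \<Longrightarrow> twisted (\<lambda>h. \<sigma> h b)"
| mult_left: "a \<in> A \<Longrightarrow> twisted \<delta> \<Longrightarrow> twisted (\<lambda>h. a * \<delta> h)"
| diff: "twisted \<delta> \<Longrightarrow> twisted \<epsilon> \<Longrightarrow> twisted (\<lambda>h. \<delta> h - \<epsilon> h)"
| agree: "twisted \<delta> \<Longrightarrow> (\<And>h. h \<in> \<Gamma> \<Longrightarrow> \<epsilon> h = \<delta> h) \<Longrightarrow> twisted \<epsilon>"

lemma twisted_closed: "twisted \<delta> \<Longrightarrow> h \<in> \<Gamma> \<Longrightarrow> \<delta> h \<in> A"
  by (induction rule: twisted.induct) (auto intro: hom_closed mult_closed diff_closed)

lemma twisted_zero: "twisted (\<lambda>h. 0)"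
  using twisted.diff[OF twisted.hom[OF zero_closed] twisted.hom[OF zero_closed]] by simp

lemma twisted_add: "twisted \<delta> \<Longrightarrow> twisted \<epsilon> \<Longrightarrow> twisted (\<lambda>h. \<delta> h + \<epsilon> h)"
  using twisted.diff[OF _ twisted.diff[OF twisted_zero], of \<delta> \<epsilon>] by simp

lemma twisted_sum: "(\<And>i. i \<in> B \<Longrightarrow> twisted (\<delta> i)) \<Longrightarrow> twisted (\<lambda>h. \<Sum>i\<in>B. \<delta> i h)"
  by (induction B rule: infinite_finite_induct) (auto intro: twisted_zero twisted_add)

text \<open>On generators this is \<open>\<sigma> h c * \<sigma> h b = \<sigma> h (c * b)\<close>;
  the other rules commute with multiplication from the right.\<close>

lemma twisted_mult_right: "twisted \<delta> \<Longrightarrow> b \<in> A \<Longrightarrow> twisted (\<lambda>h. \<delta> h * \<sigma> h b)"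
proof (induction rule: twisted.induct)
  case (hom c)
  then show ?case
    by (intro twisted.agree[OF twisted.hom[of "c * b"]]) (auto simp: hom_mult mult_closed)
next
  case (mult_left a \<delta>)
  then show ?case by (simp add: mult.assoc twisted.mult_left)
next
  case (diff \<delta> \<epsilon>)
  then show ?case by (simp add: left_diff_distrib twisted.diff)
next
  case (agree \<delta> \<epsilon>)
  then show ?case by (intro twisted.agree[where \<epsilon> = "\<lambda>h. \<epsilon> h * \<sigma> h b"]) auto
qed

text \<open>The ideal \<open>P\<^sub>\<Lambda>\<close> of the overview; the isolating function
  \<open>\<delta>\<close> may depend on the point \<open>g\<close>.\<close>

definition separating :: "'i set \<Rightarrow> 'a set" where
  "separating \<Lambda> = {c \<in> A. \<forall>g\<in>\<Lambda>. \<exists>\<delta>. twisted \<delta> \<and> \<delta> g = c \<and> (\<forall>h\<in>\<Lambda> - {g}. \<delta> h = 0)}"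

lemma separating_subset: "separating \<Lambda> \<subseteq> A"
  by (auto simp: separating_def)

lemma separating_mult_left:
  assumes "c \<in> separating \<Lambda>" "a \<in> A"
  shows "a * c \<in> separating \<Lambda>"
proof -
  have "\<exists>\<epsilon>. twisted \<epsilon> \<and> \<epsilon> g = a * c \<and> (\<forall>h\<in>\<Lambda> - {g}. \<epsilon> h = 0)" if g: "g \<in> \<Lambda>" for g
  proof -
    obtain \<delta> where "twisted \<delta>" "\<delta> g = c" "\<forall>h\<in>\<Lambda> - {g}. \<delta> h = 0"
      using assms(1) g by (auto simp: separating_def)
    with assms(2) show ?thesis
      by (intro exI[of _ "\<lambda>h. a * \<delta> h"]) (auto intro: twisted.mult_left)
  qed
  then show ?thesis
    using assms by (auto simp: separating_def intro: mult_closed)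
qed

text \<open>Write \<open>a = \<sigma> g b\<close> and multiply the isolating function by
  \<open>\<sigma> h b\<close>: its zeros stay and its value at \<open>g\<close> becomes
  \<open>c * a\<close>.\<close>

lemma separating_mult_right:
  assumes "\<Lambda> \<subseteq> \<Gamma>" "c \<in> separating \<Lambda>" "a \<in> A"
  shows "c * a \<in> separating \<Lambda>"
proof -
  have "\<exists>\<epsilon>. twisted \<epsilon> \<and> \<epsilon> g = c * a \<and> (\<forall>h\<in>\<Lambda> - {g}. \<epsilon> h = 0)" if g: "g \<in> \<Lambda>" for g
  proof -
    obtain b where b: "b \<in> A" "\<sigma> g b = a"
      using hom_surj assms(1,3) g by blast
    obtain \<delta> where "twisted \<delta>" "\<delta> g = c" "\<forall>h\<in>\<Lambda> - {g}. \<delta> h = 0"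
      using assms(2) g by (auto simp: separating_def)
    with b show ?thesis
      by (intro exI[of _ "\<lambda>h. \<delta> h * \<sigma> h b"]) (auto intro: twisted_mult_right)
  qed
  then show ?thesis
    using assms by (auto simp: separating_def intro: mult_closed)
qed

text \<open>One point imposes no vanishing condition, and \<open>\<sigma> g\<close> takes every
  value in \<open>A\<close>.\<close>

lemma separating_singleton: "g \<in> \<Gamma> \<Longrightarrow> separating {g} = A"
  unfolding separating_def using hom_surj twisted.hom by fastforce

text \<open>
  The interpolation step: \<open>f\<close> is the interpolant of the constant \<open>c\<close> on \<open>\<Lambda>\<close>, and its error
  \<open>c - f h\<close> at a further point \<open>h\<close> yields functions that separate the points of \<open>\<Lambda> \<union> {h}\<close>.
\<close>

lemma separating_insert:
  assumes "\<Lambda> \<subseteq> \<Gamma>" "h \<in> \<Gamma> - \<Lambda>" "c \<in> A" "c' \<in> separating \<Lambda>"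
    and f: "twisted f" "\<And>g. g \<in> \<Lambda> \<Longrightarrow> f g = c"
  shows "(c - f h) * c' \<in> separating (insert h \<Lambda>)"
proof -
  have c': "c' \<in> A" using assms(4) separating_subset by blast
  have f_h: "c - f h \<in> A" using assms(2,3) f(1) twisted_closed diff_closed by blast
  \<comment> \<open>These functions vanish on \<open>\<Lambda>\<close>, where \<open>f\<close>
    equals \<open>c\<close>, and their value at \<open>h\<close> is controlled through
    \<open>z\<close>.\<close>
  have error: "twisted (\<lambda>g. (c - f g) * \<sigma> g z)" if "z \<in> A" for z
    using twisted.diff[OF twisted.mult_left[OF assms(3) twisted.hom] twisted_mult_right[OF f(1)], of z z] that
    by (simp add: left_diff_distrib)
  have "\<exists>\<epsilon>. twisted \<epsilon> \<and> \<epsilon> g = (c - f h) * c' \<and> (\<forall>k\<in>insert h \<Lambda> - {g}. \<epsilon> k = 0)"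
    if "g \<in> insert h \<Lambda>" for g
  proof (cases "g = h")
    case True
    obtain z where "z \<in> A" "\<sigma> h z = c'" using hom_surj assms(2) c' by blast
    then show ?thesis
      using True f(2) error by (intro exI[of _ "\<lambda>g. (c - f g) * \<sigma> g z"]) auto
  next
    case False
    then have "g \<in> \<Lambda>" using that by simp
    then obtain \<delta> where \<delta>: "twisted \<delta>" "\<delta> g = c'" "\<forall>k\<in>\<Lambda> - {g}. \<delta> k = 0"
      using assms(4) by (auto simp: separating_def)
    obtain z where z: "z \<in> A" "\<sigma> h z = \<delta> h"
      using hom_surj assms(2) twisted_closed[OF \<delta>(1)] by blast
    \<comment> \<open>At \<open>h\<close> the two terms cancel by the choice of \<open>z\<close>; on
      \<open>\<Lambda>\<close> the second term vanishes.\<close>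
    let ?\<epsilon> = "\<lambda>k. (c - f h) * \<delta> k - (c - f k) * \<sigma> k z"
    have "?\<epsilon> k = 0" if "k \<in> insert h \<Lambda> - {g}" for k
      using that \<delta>(3) f(2) z(2) by (cases "k = h") auto
    moreover have "twisted ?\<epsilon>"
      using error[OF z(1)] twisted.mult_left[OF f_h \<delta>(1)] by (rule twisted.diff[rotated])
    ultimately show ?thesis
      using \<open>g \<in> \<Lambda>\<close> \<delta>(2) f(2) by (intro exI[of _ ?\<epsilon>]) auto
  qed
  then show ?thesis
    using mult_closed[OF f_h c'] unfolding separating_def by blast
qed

end

section \<open>Layers between the ring and an ideal containing the traces\<close>

locale trace_ideal = surjective_family +
  fixes I :: "'a set"
  assumes ideal_zero: "0 \<in> I"
    and ideal_diff: "x \<in> I \<Longrightarrow> y \<in> I \<Longrightarrow> x - y \<in> I"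
    and ideal_mult_left: "a \<in> A \<Longrightarrow> x \<in> I \<Longrightarrow> a * x \<in> I"
    and ideal_mult_right: "a \<in> A \<Longrightarrow> x \<in> I \<Longrightarrow> x * a \<in> I"
    and ideal_root: "nat_multiple (card \<Gamma>) x \<in> I \<Longrightarrow> x \<in> I"
    and trace_in_ideal: "r \<in> A \<Longrightarrow> trace r \<in> I"
begin

text \<open>Generators sum to traces, and the other rules act on the sum by ideal
  operations.\<close>

lemma sum_twisted_in_ideal: "twisted \<delta> \<Longrightarrow> (\<Sum>h\<in>\<Gamma>. \<delta> h) \<in> I"
proof (induction rule: twisted.induct)
  case (hom b)
  then show ?case using trace_in_ideal by (simp add: trace_def)
next
  case (mult_left a \<delta>)
  then show ?case using ideal_mult_left[of a "\<Sum>h\<in>\<Gamma>. \<delta> h"] by (simp add: sum_distrib_left)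
next
  case (diff \<delta> \<epsilon>)
  then show ?case using ideal_diff by (simp add: sum_subtractf)
next
  case (agree \<delta> \<epsilon>)
  then have "(\<Sum>h\<in>\<Gamma>. \<epsilon> h) = (\<Sum>h\<in>\<Gamma>. \<delta> h)" by (intro sum.cong) auto
  then show ?case using agree.IH by simp
qed

text \<open>For nonempty \<open>\<Gamma>\<close> the layers start above \<open>A\<close> at
  \<open>m = 1\<close> and end inside \<open>I\<close> at \<open>m = card \<Gamma>\<close>. The
  closure absorbs the factor \<open>card \<Gamma>\<close> lost in each interpolation. The
  intersection \<open>I \<inter> A\<close> appears because \<open>I\<close> will be a residual that
  can reach outside \<open>A\<close>.\<close>

definition layer :: "nat \<Rightarrow> 'a set" where
  "layer m = pure_closure (card \<Gamma>) (I \<inter> A \<union> (\<Union>\<Lambda>\<in>{\<Lambda>. \<Lambda> \<subseteq> \<Gamma> \<and> card \<Lambda> = m}. separating \<Lambda>))"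

lemma layer_ideal: "x \<in> I \<Longrightarrow> x \<in> A \<Longrightarrow> x \<in> layer m"
  unfolding layer_def by (auto intro: pure_closure.base)

lemma layer_separating: "\<Lambda> \<subseteq> \<Gamma> \<Longrightarrow> c \<in> separating \<Lambda> \<Longrightarrow> c \<in> layer (card \<Lambda>)"
  unfolding layer_def by (auto intro: pure_closure.base)

lemma layer_mult_left: "x \<in> layer m \<Longrightarrow> a \<in> A \<Longrightarrow> a * x \<in> layer m"
  unfolding layer_def
  by (erule pure_closure_map[where f = "(*) a", rotated 2])
    (auto simp: additive_def distrib_left intro!: pure_closure.base ideal_mult_left separating_mult_left mult_closed)

lemma layer_mult_right: "x \<in> layer m \<Longrightarrow> a \<in> A \<Longrightarrow> x * a \<in> layer m"
  unfolding layer_def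
  by (erule pure_closure_map[where f = "\<lambda>x. x * a", rotated 2])
    (auto simp: additive_def distrib_right intro!: pure_closure.base ideal_mult_right separating_mult_right mult_closed)

text \<open>Lagrange's form: add up the functions that isolate \<open>c\<close> at the single points
  of \<open>\<Lambda>\<close>.\<close>

lemma interpolant:
  assumes "\<Lambda> \<subseteq> \<Gamma>" "c \<in> separating \<Lambda>"
  obtains f where "twisted f" "\<And>g. g \<in> \<Lambda> \<Longrightarrow> f g = c"
proof -
  obtain \<delta> where \<delta>: "\<And>g. g \<in> \<Lambda> \<Longrightarrow> twisted (\<delta> g)" "\<And>g. g \<in> \<Lambda> \<Longrightarrow> \<delta> g g = c"
    "\<And>g h. g \<in> \<Lambda> \<Longrightarrow> h \<in> \<Lambda> - {g} \<Longrightarrow> \<delta> g h = 0"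
    using assms(2) unfolding separating_def mem_Collect_eq by metis
  have fin: "finite \<Lambda>" using assms(1) finite_index finite_subset by blast
  have "(\<Sum>k\<in>\<Lambda>. \<delta> k g) = c" if "g \<in> \<Lambda>" for g
  proof -
    have "(\<Sum>k\<in>\<Lambda>. \<delta> k g) = (\<Sum>k\<in>\<Lambda>. if k = g then c else 0)"
      using that \<delta>(2,3) by (intro sum.cong) auto
    then show ?thesis using that fin by simp
  qed
  then show ?thesis
    using that[OF twisted_sum[of \<Lambda> \<delta>]] \<delta>(1) by blast
qed

text \<open>Sum the errors \<open>(c - f h) * c'\<close> of the interpolant over
  \<open>\<Gamma>\<close>: those in \<open>\<Lambda>\<close> vanish, the others lie one layer up.
  Adding \<open>(\<Sum>h\<in>\<Gamma>. f h) * c'\<close>, a member of \<open>I\<close>, gives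
  \<open>card \<Gamma>\<close> times \<open>c * c'\<close>.\<close>

lemma separating_mult_separating:
  assumes "\<Lambda> \<subseteq> \<Gamma>" "c \<in> separating \<Lambda>" "c' \<in> separating \<Lambda>"
  shows "c * c' \<in> layer (Suc (card \<Lambda>))"
proof -
  obtain f where f: "twisted f" "\<And>g. g \<in> \<Lambda> \<Longrightarrow> f g = c"
    using interpolant[OF assms(1,2)] by blast
  have mem: "c \<in> A" "c' \<in> A" using assms separating_subset by blast+
  have "(c - f h) * c' \<in> layer (Suc (card \<Lambda>))" if "h \<in> \<Gamma>" for h
  proof (cases "h \<in> \<Lambda>")
    case True
    then show ?thesis using f(2) layer_ideal[OF ideal_zero zero_closed] by simp
  next
    case False
    then have "card (insert h \<Lambda>) = Suc (card \<Lambda>)"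
      using assms(1) finite_index by (meson card_insert_disjoint finite_subset)
    then show ?thesis
      using layer_separating[OF _ separating_insert[OF assms(1) _ mem(1) assms(3) f]] False that assms(1)
      by (metis DiffI insert_subset)
  qed
  then have "(\<Sum>h\<in>\<Gamma>. (c - f h) * c') \<in> layer (Suc (card \<Lambda>))"
    unfolding layer_def by (intro pure_closure_sum)
  moreover have "(\<Sum>h\<in>\<Gamma>. f h) * c' \<in> layer (Suc (card \<Lambda>))"
  proof (rule layer_ideal)
    show "(\<Sum>h\<in>\<Gamma>. f h) * c' \<in> I"
      using f(1) mem(2) by (intro ideal_mult_right sum_twisted_in_ideal)
    show "(\<Sum>h\<in>\<Gamma>. f h) * c' \<in> A"
      using twisted_closed[OF f(1)] mem(2) by (intro mult_closed sum_closed)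
  qed
  ultimately have "(\<Sum>h\<in>\<Gamma>. (c - f h) * c') + (\<Sum>h\<in>\<Gamma>. f h) * c' \<in> layer (Suc (card \<Lambda>))"
    unfolding layer_def by (intro pure_closure_add)
  moreover have "(\<Sum>h\<in>\<Gamma>. (c - f h) * c') + (\<Sum>h\<in>\<Gamma>. f h) * c' = nat_multiple (card \<Gamma>) (c * c')"
    using finite_index
    by (simp add: left_diff_distrib sum_subtractf sum_distrib_right sum_const_eq_nat_multiple)
  ultimately show ?thesis
    unfolding layer_def by (metis pure_closure.root)
qed

text \<open>The interpolant is constant on \<open>\<Gamma>\<close>, so its sum, a member of
  \<open>I\<close>, is \<open>card \<Gamma>\<close> times \<open>c\<close>.\<close>

lemma separating_all: "separating \<Gamma> \<subseteq> I"
proof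
  fix c assume "c \<in> separating \<Gamma>"
  then obtain f where f: "twisted f" "\<And>g. g \<in> \<Gamma> \<Longrightarrow> f g = c"
    using interpolant[of \<Gamma> c] by blast
  then have "nat_multiple (card \<Gamma>) c = (\<Sum>h\<in>\<Gamma>. f h)"
    using finite_index by (simp flip: sum_const_eq_nat_multiple)
  then show "c \<in> I"
    using sum_twisted_in_ideal[OF f(1)] ideal_root by simp
qed

lemma layer_card: "layer (card \<Gamma>) \<subseteq> I"
proof
  fix x assume "x \<in> layer (card \<Gamma>)"
  then show "x \<in> I"
    unfolding layer_def
  proof (rule pure_closure_minimal)
    have "\<Lambda> = \<Gamma>" if "\<Lambda> \<subseteq> \<Gamma>" "card \<Lambda> = card \<Gamma>" for \<Lambda>
      using that finite_index card_subset_eq by blast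
    then show "I \<inter> A \<union> (\<Union>\<Lambda>\<in>{\<Lambda>. \<Lambda> \<subseteq> \<Gamma> \<and> card \<Lambda> = card \<Gamma>}. separating \<Lambda>) \<subseteq> I"
      using separating_all by auto
  qed (auto intro: ideal_zero ideal_diff ideal_root)
qed

lemma list_product_in_layer:
  assumes "set us \<subseteq> A" "set vs \<subseteq> A" "x \<in> layer m"
  shows "list_product (us @ [x] @ vs) \<in> layer m"
proof -
  have "foldl (*) x vs \<in> layer m"
    using assms(2,3) by (induction vs arbitrary: x) (auto simp: layer_mult_right)
  then have "list_product (x # vs) \<in> layer m"
    by (simp add: foldl_mult_eq_list_product)
  then show ?thesis
    using assms(1) by (induction us) (auto simp: list_product_Cons layer_mult_left)
qed

lemma products_in_layer_Suc:
  assumes "m \<ge> 1"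
  shows "products_in (layer m) ((card \<Gamma> choose m) + 1) (layer (Suc m))"
  unfolding layer_def
proof (rule products_in_pure_closure, fold layer_def)
  let ?X = "\<Union>\<Lambda>\<in>{\<Lambda>. \<Lambda> \<subseteq> \<Gamma> \<and> card \<Lambda> = m}. separating \<Lambda>"
  show "products_in (I \<inter> A \<union> ?X) ((card \<Gamma> choose m) + 1) (layer (Suc m))"
    unfolding products_in_def
  proof (intro allI impI, elim conjE)
    fix xs assume xs: "set xs \<subseteq> I \<inter> A \<union> ?X" "length xs = (card \<Gamma> choose m) + 1"
    then have xs_A: "set xs \<subseteq> A" using separating_subset by blast
    show "list_product xs \<in> layer (Suc m)"
    proof (cases "set xs \<inter> I = {}")
      case False
      \<comment> \<open>A single factor in \<open>I\<close> absorbs the whole product.\<close>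
      then obtain us x vs where "xs = us @ [x] @ vs" "x \<in> I"
        by (metis Int_emptyI append_Cons append_Nil split_list)
      then show ?thesis
        using xs_A list_product_in_layer[of us vs x] layer_ideal by simp
    next
      case True
      then have "\<forall>x\<in>set xs. \<exists>\<Lambda>. \<Lambda> \<subseteq> \<Gamma> \<and> card \<Lambda> = m \<and> x \<in> separating \<Lambda>"
        using xs(1) by blast
      then obtain \<phi> where \<phi>: "\<And>x. x \<in> set xs \<Longrightarrow> \<phi> x \<subseteq> \<Gamma> \<and> card (\<phi> x) = m \<and> x \<in> separating (\<phi> x)"
        by metis
      \<comment> \<open>Only \<open>card \<Gamma> choose m\<close> labels \<open>\<phi> x\<close>
        are possible, one fewer than there are factors, so a label repeats.\<close>
      have "card (set (map \<phi> xs)) \<le> card {\<Lambda>. \<Lambda> \<subseteq> \<Gamma> \<and> card \<Lambda> = m}"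
        using \<phi> finite_index by (intro card_mono) auto
      then have "card (set (map \<phi> xs)) < length (map \<phi> xs)"
        using xs(2) finite_index by (simp add: n_subsets)
      then have "\<not> distinct (map \<phi> xs)"
        by (metis distinct_card less_irrefl)
      then obtain us p vs q ws where split: "xs = us @ [p] @ vs @ [q] @ ws" "\<phi> p = \<phi> q"
        using not_distinct_map_decomp by blast
      have sub: "set us \<subseteq> A" "set vs \<subseteq> A" "set ws \<subseteq> A" and pq: "p \<in> set xs" "q \<in> set xs"
        using xs_A split(1) by auto
      \<comment> \<open>The factors between \<open>p\<close> and \<open>q\<close> are absorbed into
        \<open>q\<close>, which makes two members of one separating ideal adjacent.\<close>
      have "list_product (vs @ [q]) \<in> separating (\<phi> q)"
        using sub(2) \<phi>[OF pq(2)] by (induction vs) (auto simp: list_product_Cons separating_mult_left)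
      then have "list_product ([p] @ vs @ [q]) \<in> layer (Suc m)"
        using separating_mult_separating[of "\<phi> p" p] \<phi>[OF pq(1)] split(2)
        by (simp add: list_product_Cons)
      then have "list_product (us @ [list_product ([p] @ vs @ [q])] @ ws) \<in> layer (Suc m)"
        using sub by (intro list_product_in_layer)
      moreover have "list_product (us @ [list_product ys] @ ws) = list_product (us @ ys @ ws)"
        if "ys \<noteq> []" for ys
        using that by (cases "us = []"; cases "ws = []") (auto simp: list_product_append list_product_Cons)
      ultimately show ?thesis
        using split(1) by (metis append.assoc append_is_Nil_conv not_Cons_self2)
    qed
  qed
qed

text \<open>The exponents of the single steps multiply; the empty product at \<open>m = 1\<close>
  stands for \<open>A \<subseteq> layer 1\<close>.\<close>

lemma products_in_layer:
  assumes "1 \<le> m" "m \<le> card \<Gamma>"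
  shows "products_in A (\<Prod>i=1..<m. (card \<Gamma> choose i) + 1) (layer m)"
  using assms
proof (induction m rule: nat_induct_at_least)
  case base
  then obtain g where "g \<in> \<Gamma>" by fastforce
  then have "A \<subseteq> layer 1"
    using layer_separating[of "{g}"] separating_singleton[of g] by auto
  then show ?case by (simp add: products_in_1)
next
  case (Suc m)
  have "1 \<le> (\<Prod>i=1..<m. (card \<Gamma> choose i) + 1)"
    by (simp add: Suc_le_eq prod_pos)
  then have "products_in A ((\<Prod>i=1..<m. (card \<Gamma> choose i) + 1) * ((card \<Gamma> choose m) + 1)) (layer (Suc m))"
    using Suc products_in_layer_Suc by (intro products_in_trans[where Y = "layer m"]) auto
  then show ?case using Suc.hyps by simp
qed

lemma products_in_ideal:
  assumes "\<Gamma> \<noteq> {}"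
  shows "products_in A (\<Prod>i=1..<card \<Gamma>. (card \<Gamma> choose i) + 1) I"
proof -
  have "1 \<le> card \<Gamma>"
    using assms finite_index by (simp add: Suc_le_eq card_gt_0_iff)
  then show ?thesis
    using products_in_layer[of "card \<Gamma>"] layer_card products_in_mono by blast
qed

end

section \<open>The quantitative theorem of Bergman and Isaacs\<close>

lemma prod_binomial_eq_double:
  assumes "n \<ge> 1"
  shows "(\<Prod>i=1..n. (n choose i) + 1) = (\<Prod>i=1..<n. (n choose i) + 1) * 2"
  using assms by (simp add: prod.last_plus)

text \<open>Invariance makes every \<open>\<sigma> h\<close>, and hence \<open>trace\<close>, left
  linear over traces, so that the right ideals \<open>trace_power j\<close> are stable.\<close>

locale invariant_trace_family = surjective_family S \<Gamma> \<sigma>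
  for S :: "'a::ring set" and \<Gamma> :: "'i set" and \<sigma> :: "'i \<Rightarrow> 'a \<Rightarrow> 'a" +
  assumes nonempty: "\<Gamma> \<noteq> {}"
    and trace_invariant: "h \<in> \<Gamma> \<Longrightarrow> r \<in> S \<Longrightarrow> \<sigma> h (trace r) = trace r"
begin

text \<open>\<open>trace_power j\<close> is the right ideal \<open>T\<^sup>j S\<close>, where \<open>T\<close> is the set of traces.\<close>

primrec trace_power :: "nat \<Rightarrow> 'a set" where
  "trace_power 0 = S"
| "trace_power (Suc j) = pure_closure 1 {trace r * v |r v. r \<in> S \<and> v \<in> trace_power j}"

declare trace_power.simps(2) [simp del]

lemma trace_power_SucI: "r \<in> S \<Longrightarrow> v \<in> trace_power j \<Longrightarrow> trace r * v \<in> trace_power (Suc j)"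
  by (auto simp: trace_power.simps(2) intro: pure_closure.base)

lemma trace_power_zero: "0 \<in> trace_power j"
  by (cases j) (auto simp: trace_power.simps(2) intro: zero_closed pure_closure.zero)

lemma trace_power_diff: "x \<in> trace_power j \<Longrightarrow> y \<in> trace_power j \<Longrightarrow> x - y \<in> trace_power j"
  by (cases j) (auto simp: trace_power.simps(2) intro: diff_closed pure_closure.diff)

text \<open>For \<open>k = 1\<close> the rule \<open>root\<close> of the closure is vacuous.\<close>

lemma trace_power_induct [consumes 1, case_names zero prod diff]:
  assumes "x \<in> trace_power (Suc j)" "P 0"
    "\<And>r v. r \<in> S \<Longrightarrow> v \<in> trace_power j \<Longrightarrow> P (trace r * v)"
    "\<And>x y. x \<in> trace_power (Suc j) \<Longrightarrow> y \<in> trace_power (Suc j) \<Longrightarrow> P x \<Longrightarrow> P y \<Longrightarrow> P (x - y)"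
  shows "P x"
proof -
  have "x \<in> trace_power (Suc j) \<and> P x"
    using assms(1) unfolding trace_power.simps(2)
  proof (induction rule: pure_closure.induct)
    case (base x)
    then show ?case using assms(3) by (auto intro: pure_closure.base)
  qed (use assms(2) assms(4)[unfolded trace_power.simps(2)] in \<open>auto intro: pure_closure.zero pure_closure.diff\<close>)
  then show ?thesis by blast
qed

lemma trace_power_subset: "trace_power j \<subseteq> S"
proof (induction j)
  case (Suc j)
  have "x \<in> S" if "x \<in> trace_power (Suc j)" for x
    using that
  proof (induction rule: trace_power_induct)
    case (prod r v)
    then show ?case using Suc by (auto intro: mult_closed trace_closed)
  qed (auto intro: zero_closed diff_closed)
  then show ?case by blast
qed simp

lemma trace_power_mult_right: "x \<in> trace_power j \<Longrightarrow> a \<in> S \<Longrightarrow> x * a \<in> trace_power j"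
proof (induction j arbitrary: x)
  case 0
  then show ?case by (simp add: mult_closed)
next
  case (Suc j)
  show ?case
    using Suc.prems(1)
  proof (induction rule: trace_power_induct)
    case (prod r v)
    then show ?case
      using trace_power_SucI[OF _ Suc.IH[OF _ Suc.prems(2)], of r v] by (simp add: mult.assoc)
  next
    case (diff x y)
    then show ?case by (simp add: left_diff_distrib trace_power_diff)
  qed (simp add: trace_power_zero)
qed

lemma hom_trace_mult: "h \<in> \<Gamma> \<Longrightarrow> r \<in> S \<Longrightarrow> x \<in> S \<Longrightarrow> \<sigma> h (trace r * x) = trace r * \<sigma> h x"
  by (simp add: hom_mult trace_closed trace_invariant)

text \<open>As \<open>\<sigma> h\<close> commutes with left multiplication by traces,
  \<open>trace r * w\<close> is a preimage of \<open>trace r * v\<close> whenever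
  \<open>\<sigma> h w = v\<close>. Thus the family restricts to
  \<open>trace_power j\<close>.\<close>

lemma trace_power_image:
  assumes h: "h \<in> \<Gamma>"
  shows "\<sigma> h ` trace_power j = trace_power j"
proof (induction j)
  case 0
  then show ?case using h by (simp add: image_eq)
next
  case (Suc j)
  have sub: "x \<in> S" if "x \<in> trace_power k" for x k
    using that trace_power_subset by blast
  have "\<sigma> h x \<in> trace_power (Suc j)" if "x \<in> trace_power (Suc j)" for x
    using that
  proof (induction rule: trace_power_induct)
    case zero
    then show ?case using h trace_power_zero by (simp add: hom_zero)
  next
    case (prod r v)
    then have "\<sigma> h v \<in> trace_power j" using Suc.IH by blast
    then show ?case
      using prod h trace_power_SucI[of r "\<sigma> h v" j] by (simp add: hom_trace_mult sub)
  next
    case (diff x y)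
    then show ?case using h trace_power_diff by (simp add: hom_diff sub)
  qed
  moreover have "\<exists>y\<in>trace_power (Suc j). \<sigma> h y = x" if "x \<in> trace_power (Suc j)" for x
    using that
  proof (induction rule: trace_power_induct)
    case zero
    then show ?case using h hom_zero trace_power_zero by blast
  next
    case (prod r v)
    then obtain w where "w \<in> trace_power j" "\<sigma> h w = v" using Suc.IH by (metis imageE)
    then show ?case
      using prod h by (intro bexI[OF _ trace_power_SucI[of r w j]]) (auto simp: hom_trace_mult sub)
  next
    case (diff x y)
    then obtain x' y' where "x' \<in> trace_power (Suc j)" "\<sigma> h x' = x"
      "y' \<in> trace_power (Suc j)" "\<sigma> h y' = y" by blast
    then show ?case
      using h by (intro bexI[of _ "x' - y'"] trace_power_diff) (auto simp: hom_diff sub)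
  qed
  ultimately show ?case by blast
qed

text \<open>Left linearity over traces pulls the factors of \<open>v\<close> out of its trace. The
  factor \<open>y\<close> supplies the last element of \<open>S\<close>, which
  \<open>trace v\<close> alone would lack.\<close>

lemma trace_trace_power_mult:
  "v \<in> trace_power j \<Longrightarrow> y \<in> S \<Longrightarrow> trace v * y \<in> trace_power (Suc j)"
proof (induction j arbitrary: v)
  case 0
  then show ?case using trace_power_SucI[of v y 0] by (simp)
next
  case (Suc j)
  have sub: "x \<in> S" if "x \<in> trace_power k" for x k
    using that trace_power_subset by blast
  show ?case
    using Suc.prems(1)
  proof (induction rule: trace_power_induct)
    case zero
    have "trace 0 = 0" by (simp add: trace_def hom_zero)
    then show ?case using trace_power_zero by (simp)
  next
    case (prod r v)
    have "trace (trace r * v) = trace r * trace v"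
      using prod unfolding trace_def[of "trace r * v"]
      by (simp add: hom_trace_mult sub trace_def[of v] sum_distrib_left)
    then show ?case
      using trace_power_SucI[OF prod(1) Suc.IH[OF prod(2) Suc.prems(2)]] by (simp add: mult.assoc)
  next
    case (diff x z)
    then show ?case
      using trace_power_diff by (simp add: trace_diff sub left_diff_distrib)
  qed
qed

text \<open>The set \<open>trace_power j\<close> is joined explicitly because, without an identity,
  its left multiples need not contain it.\<close>

definition trace_ideal_power :: "nat \<Rightarrow> 'a set" where
  "trace_ideal_power j =
     pure_closure (card \<Gamma>) (trace_power j \<union> {x * v |x v. x \<in> S \<and> v \<in> trace_power j})"

lemma trace_ideal_power_base: "v \<in> trace_power j \<Longrightarrow> v \<in> trace_ideal_power j"
  unfolding trace_ideal_power_def by (blast intro: pure_closure.base)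

lemma trace_ideal_power_mult_left:
  assumes "x \<in> trace_ideal_power j" "a \<in> S"
  shows "a * x \<in> trace_ideal_power j"
  using assms(1) unfolding trace_ideal_power_def
proof (rule pure_closure_map[where f = "(*) a", rotated 2])
  fix x assume "x \<in> trace_power j \<union> {x * v |x v. x \<in> S \<and> v \<in> trace_power j}"
  then consider "x \<in> trace_power j" | y v where "x = y * v" "y \<in> S" "v \<in> trace_power j" by blast
  then have "\<exists>y v. a * x = y * v \<and> y \<in> S \<and> v \<in> trace_power j"
  proof cases
    case 2
    then show ?thesis
      using mult_closed[OF assms(2)] by (intro exI[of _ "a * y"] exI[of _ v]) (simp add: mult.assoc)
  qed (use assms(2) in blast)
  then show "a * x \<in> pure_closure (card \<Gamma>) (trace_power j \<union> {x * v |x v. x \<in> S \<and> v \<in> trace_power j})"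
    by (blast intro: pure_closure.base)
qed (simp add: additive_def distrib_left)

text \<open>
  The factor \<open>i = card \<Gamma>\<close> of \<open>h\<close> is \<open>2\<close>. The first half of the \<open>h\<close> factors reaches only the residual
  \<open>I\<close>, and the second half brings the product from \<open>I\<close> into \<open>trace_ideal_power (Suc j)\<close>.
\<close>

lemma products_trace_power:
  "products_in (trace_power j) (\<Prod>i=1..card \<Gamma>. (card \<Gamma> choose i) + 1) (trace_ideal_power (Suc j))"
proof -
  let ?W = "trace_ideal_power (Suc j)" and ?f = "\<Prod>i=1..<card \<Gamma>. (card \<Gamma> choose i) + 1"
  \<comment> \<open>Traces of elements of \<open>trace_power j\<close> are only known to reach
    \<open>?W\<close> after multiplication by such an element; hence the residual.\<close>
  define I where "I = {x. \<forall>y\<in>trace_power j. x * y \<in> ?W}"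
  have sub: "x \<in> S" if "x \<in> trace_power k" for x k
    using that trace_power_subset by blast
  interpret V: surjective_family "trace_power j" \<Gamma> \<sigma>
    by unfold_locales
      (auto simp: finite_index trace_power_zero trace_power_diff trace_power_mult_right hom_add hom_mult
        trace_power_image sub)
  interpret V: trace_ideal "trace_power j" \<Gamma> \<sigma> I
  proof unfold_locales
    show "0 \<in> I"
      by (simp add: I_def trace_ideal_power_def pure_closure.zero)
    show "x - y \<in> I" if "x \<in> I" "y \<in> I" for x y
      using that by (auto simp: I_def trace_ideal_power_def left_diff_distrib intro: pure_closure.diff)
    show "a * x \<in> I" if "a \<in> trace_power j" "x \<in> I" for a x
      using that by (auto simp: I_def mult.assoc intro: trace_ideal_power_mult_left sub)
    show "x * a \<in> I" if "a \<in> trace_power j" "x \<in> I" for a x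
      using that by (auto simp: I_def mult.assoc V.mult_closed)
    show "x \<in> I" if "nat_multiple (card \<Gamma>) x \<in> I" for x
      using that unfolding I_def trace_ideal_power_def
      by (auto simp: mult_nat_multiple_left intro: pure_closure.root)
    show "trace r \<in> I" if "r \<in> trace_power j" for r
      using that by (simp add: I_def trace_ideal_power_base trace_trace_power_mult sub)
  qed
  have n: "1 \<le> card \<Gamma>"
    using nonempty finite_index by (simp add: Suc_le_eq card_gt_0_iff)
  have f: "1 \<le> ?f" by (simp add: Suc_le_eq prod_pos)
  have "list_product xs \<in> trace_power j" if "set xs \<subseteq> trace_power j" "xs \<noteq> []" for xs
    using that by (induction xs rule: list_product.induct) (auto intro: V.mult_closed)
  moreover have "?f \<noteq> 0" using f by linarith
  ultimately have "products_in (trace_power j) ?f (trace_power j)"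
    unfolding products_in_def by (metis list.size(3))
  then have "products_in (trace_power j) ?f (I \<inter> trace_power j)"
    using V.products_in_ideal[OF nonempty] by (simp add: products_in_def)
  moreover have "products_in (I \<inter> trace_power j) 2 ?W"
    by (auto simp: products_in_def I_def numeral_2_eq_2 length_Suc_conv)
  ultimately show ?thesis
    unfolding prod_binomial_eq_double[OF n] using f by (intro products_in_trans) auto
qed

text \<open>In a product of generators \<open>a * v\<close> each inner coefficient is absorbed by
  the element of the right ideal to its left. At most one coefficient survives, in front, and the
  number of factors from \<open>trace_power j\<close> is unchanged.\<close>

lemma products_trace_ideal_power_Suc:
  "products_in (trace_ideal_power j) (\<Prod>i=1..card \<Gamma>. (card \<Gamma> choose i) + 1) (trace_ideal_power (Suc j))"
  (is "products_in _ ?h ?W")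
proof -
  let ?V = "trace_power j"
  let ?X = "?V \<union> {x * v |x v. x \<in> S \<and> v \<in> ?V}"
  have collect: "\<exists>vs. set vs \<subseteq> ?V \<and> length vs = length xs
      \<and> (list_product xs = list_product vs \<or> (\<exists>a\<in>S. list_product xs = a * list_product vs))"
    if "set xs \<subseteq> ?X" "xs \<noteq> []" for xs
    using that
  proof (induction xs rule: list_product.induct)
    case (1 x)
    then consider "x \<in> ?V" | a v where "a \<in> S" "v \<in> ?V" "x = a * v" by auto
    then show ?case
    proof cases
      case 1
      then show ?thesis by (intro exI[of _ "[x]"]) auto
    next
      case 2
      then show ?thesis by (intro exI[of _ "[v]"]) auto
    qed
  next
    case (2 x y zs)
    then obtain vs where vs: "set vs \<subseteq> ?V" "length vs = length (y # zs)"
      "list_product (y # zs) = list_product vs \<or> (\<exists>b\<in>S. list_product (y # zs) = b * list_product vs)"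
      by auto
    then have "vs \<noteq> []" by auto
    have "\<exists>w\<in>?V. v * list_product (y # zs) = w * list_product vs" if "v \<in> ?V" for v
      using vs(3) that trace_power_mult_right[OF that] by (metis mult.assoc)
    then have absorb: "\<exists>w\<in>?V. v * list_product (y # zs) = list_product (w # vs)" if "v \<in> ?V" for v
      using that \<open>vs \<noteq> []\<close> by (simp add: list_product_Cons)
    from "2.prems" consider "x \<in> ?V" | a v where "a \<in> S" "v \<in> ?V" "x = a * v" by auto
    then show ?case
    proof cases
      case 1
      then obtain w where "w \<in> ?V" "x * list_product (y # zs) = list_product (w # vs)"
        using absorb by blast
      then show ?thesis
        using vs(1,2) by (intro exI[of _ "w # vs"]) simp
    next
      case 2
      then obtain w where "w \<in> ?V" "v * list_product (y # zs) = list_product (w # vs)"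
        using absorb by blast
      then have "list_product (x # y # zs) = a * list_product (w # vs)"
        using 2(3) by (simp add: mult.assoc)
      then show ?thesis
        using vs(1,2) \<open>w \<in> ?V\<close> 2(1) by (intro exI[of _ "w # vs"]) auto
    qed
  qed simp
  have "products_in ?X ?h ?W"
    unfolding products_in_def
  proof (intro allI impI, elim conjE)
    fix xs assume xs: "set xs \<subseteq> ?X" "length xs = ?h"
    have "?h \<noteq> 0" by (simp add: prod_zero_iff)
    then have "xs \<noteq> []" using xs(2) by (metis list.size(3))
    then obtain vs where vs: "set vs \<subseteq> ?V" "length vs = ?h"
      "list_product xs = list_product vs \<or> (\<exists>a\<in>S. list_product xs = a * list_product vs)"
      using collect[OF xs(1)] xs(2) by metis
    then have "list_product vs \<in> ?W"
      using products_trace_power products_inD by blast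
    then show "list_product xs \<in> ?W"
      using vs(3) trace_ideal_power_mult_left by metis
  qed
  then show ?thesis
    unfolding trace_ideal_power_def by (rule products_in_pure_closure)
qed

lemma products_trace_ideal_power:
  "products_in S ((\<Prod>i=1..card \<Gamma>. (card \<Gamma> choose i) + 1) ^ j) (trace_ideal_power j)"
proof (induction j)
  case 0
  then show ?case
    using trace_ideal_power_base[of _ 0] by (auto simp: products_in_1)
next
  case (Suc j)
  have h: "1 \<le> (\<Prod>i=1..card \<Gamma>. (card \<Gamma> choose i) + 1)" by (simp add: Suc_le_eq prod_pos)
  then have "1 \<le> (\<Prod>i=1..card \<Gamma>. (card \<Gamma> choose i) + 1) ^ j" by (rule one_le_power)
  from products_in_trans[OF this h Suc products_trace_ideal_power_Suc] show ?case
    by (simp add: mult.commute)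
qed

text \<open>If \<open>d\<close> traces always multiply to zero, then \<open>trace_power d\<close> is
  zero, and \<open>trace_ideal_power d\<close> consists of torsion only.\<close>

theorem products_pure_closure_zero:
  assumes "d \<ge> 1" "products_in (trace ` S) d {0}"
  shows "products_in S ((\<Prod>i=1..card \<Gamma>. (card \<Gamma> choose i) + 1) ^ d) (pure_closure (card \<Gamma>) {0})"
proof -
  \<comment> \<open>The list \<open>ts\<close> collects the traces already split off from
    \<open>v\<close>; at \<open>j = 0\<close> there are \<open>d\<close> of them.\<close>
  have "foldr (*) ts v = 0" if "v \<in> trace_power j" "set ts \<subseteq> trace ` S" "length ts + j = d" for v j ts
    using that
  proof (induction j arbitrary: v ts)
    case 0
    then have "ts \<noteq> []" using assms(1) by auto
    then have "foldr (*) ts v = list_product ts * v"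
      by (induction ts rule: list_product.induct) (auto simp: mult.assoc)
    then show ?case
      using 0 products_inD[OF assms(2), of ts] by simp
  next
    case (Suc j)
    have foldr_diff: "foldr (*) ts (x - y) = foldr (*) ts x - foldr (*) ts y" for x y
      by (induction ts) (auto simp: right_diff_distrib)
    show ?case
      using Suc.prems(1)
    proof (induction rule: trace_power_induct)
      case zero
      show ?case using foldr_diff[of 0 0] by simp
    next
      case (prod r v)
      then show ?case
        using Suc.IH[of v "ts @ [trace r]"] Suc.prems(2,3) by simp
    qed (simp add: foldr_diff)
  qed
  from this[of _ d "[]"] have "trace_power d \<subseteq> {0}" by auto
  then have "trace_power d \<union> {x * v |x v. x \<in> S \<and> v \<in> trace_power d} = {0}"
    using trace_power_zero by auto
  then show ?thesis
    using products_trace_ideal_power[of d] by (simp add: trace_ideal_power_def)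
qed

end

section \<open>Finite groups of automorphisms\<close>

lemma torsion_freeD:
  assumes "torsion_free k S" "x \<in> S" "nat_multiple (k ^ i) x = 0"
  shows "x = 0"
proof (cases "i = 0")
  case True
  then show ?thesis using assms(3) by simp
next
  case False
  then have "x \<in> tor k S"
    using assms(2,3) unfolding tor_def by (auto simp: Suc_le_eq)
  then show ?thesis using assms(1) by (simp add: torsion_free_def)
qed

section \<open>Additive orders\<close>

lemma nat_multiple_mod:
  assumes "nat_multiple l x = 0"
  shows "nat_multiple (k mod l) x = nat_multiple k x"
proof -
  have "nat_multiple k x = nat_multiple (k div l * l + k mod l) x" by simp
  also have "\<dots> = nat_multiple (k mod l) x"
    unfolding nat_multiple_add nat_multiple_mult by (simp add: assms)
  finally show ?thesis by simp
qed

text \<open>Let \<open>m\<close> be the additive order of \<open>x\<close>, \<open>q\<close> a prime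
  factor of \<open>m\<close>, and \<open>z\<close> the multiple of \<open>x\<close> by
  \<open>m div q\<close>.\<close>

lemma nat_multiple_prime_annihilator:
  fixes x :: "'a::ring"
  assumes "x \<noteq> 0" "nat_multiple k x = 0" "k > 0"
  obtains q and z :: 'a where "prime q" "z \<noteq> 0" "nat_multiple q z = 0"
    "\<And>l. nat_multiple l x = 0 \<Longrightarrow> q dvd l"
proof -
  define m where "m = (LEAST m. m > 0 \<and> nat_multiple m x = 0)"
  have m: "m > 0" "nat_multiple m x = 0"
    using LeastI[of "\<lambda>m. m > 0 \<and> nat_multiple m x = 0" k] assms by (auto simp: m_def)
  have least: "nat_multiple l x \<noteq> 0" if "l > 0" "l < m" for l
    using not_less_Least[of l "\<lambda>m. m > 0 \<and> nat_multiple m x = 0"] that by (auto simp: m_def)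
  have dvd: "m dvd l" if "nat_multiple l x = 0" for l
    using least[of "l mod m"] nat_multiple_mod[OF m(2), of l] m(1) that
    by (metis bot_nat_0.not_eq_extremum mod_less_divisor mod_0_imp_dvd)
  have "m \<noteq> 1" using m(2) assms(1) by auto
  then obtain q where q: "prime q" "q dvd m" using prime_factor_nat by blast
  then obtain r where r: "m = q * r" by auto
  have "nat_multiple r x \<noteq> 0"
    using m(1) prime_gt_1_nat[OF q(1)] by (intro least) (auto simp: r)
  moreover have "nat_multiple q (nat_multiple r x) = 0"
    using m(2) by (simp add: r nat_multiple_mult)
  moreover have "q dvd l" if "nat_multiple l x = 0" for l
    using q(2) dvd[OF that] by (rule dvd_trans)
  ultimately show ?thesis
    using q(1) by (intro that[of q "nat_multiple r x"]) auto
qed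

section \<open>A finite group of automorphisms\<close>

locale finite_aut_group =
  fixes G :: "('a::ring \<Rightarrow> 'a) set"
  assumes subgroup: "subgroup G ring_Aut" and finite: "finite G"
begin

sublocale group "Aut_subgroup G"
  using subgroup.subgroup_is_group[OF subgroup group_ring_Aut] .

lemma aut:
  assumes "g \<in> G"
  shows "bij g" "g (x + y) = g x + g y" "g (x * y) = g x * g y"
  using subgroup.mem_carrier[OF subgroup assms] by (auto simp: ring_Aut_def)

lemma aut_additive: "g \<in> G \<Longrightarrow> additive g"
  by (simp add: additive_def aut)

lemma aut_diff: "g \<in> G \<Longrightarrow> g (x - y) = g x - g y"
  and aut_zero: "g \<in> G \<Longrightarrow> g 0 = 0"
  and aut_sum: "g \<in> G \<Longrightarrow> g (sum f B) = (\<Sum>i\<in>B. g (f i))"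
  and aut_nat_multiple: "g \<in> G \<Longrightarrow> g (nat_multiple k x) = nat_multiple k (g x)"
  by (simp_all add: aut_additive additive.diff additive.zero additive.sum additive_nat_multiple)

lemma comp_closed: "g \<in> G \<Longrightarrow> h \<in> G \<Longrightarrow> g \<circ> h \<in> G"
  using m_closed[of g h] by (simp add: ring_Aut_def)

lemma id_closed: "id \<in> G"
  using one_closed by (simp add: ring_Aut_def)

lemma inverse_closed: "g \<in> G \<Longrightarrow> \<exists>h\<in>G. h \<circ> g = id \<and> g \<circ> h = id"
  using inv_closed[of g] l_inv[of g] r_inv[of g] by (force simp: ring_Aut_def)

lemma inverse_eq: "g \<circ> h = id \<Longrightarrow> g (h x) = x"
  by (metis comp_apply id_apply)

lemma bij_betw_comp:
  assumes "g \<in> G"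
  shows "bij_betw ((\<circ>) g) G G"
proof -
  obtain h where h: "h \<in> G" "h \<circ> g = id" "g \<circ> h = id" using inverse_closed assms by blast
  then have "h \<circ> (g \<circ> f) = f" "g \<circ> (h \<circ> f) = f" for f
    by (simp_all flip: comp_assoc)
  then show ?thesis
    using assms h(1) by (intro bij_betw_byWitness[where f' = "(\<circ>) h"]) (auto intro: comp_closed)
qed

lemma invariants_sum_orbit: "(\<Sum>g\<in>G. g x) \<in> invariants G"
proof -
  have "h (\<Sum>g\<in>G. g x) = (\<Sum>g\<in>G. g x)" if "h \<in> G" for h
    using sum.reindex_bij_betw[OF bij_betw_comp[OF that], of "\<lambda>g. g x"] that by (simp add: aut_sum)
  then show ?thesis by (simp add: invariants_def)
qed

lemma invariant_trace_family: "invariant_trace_family UNIV G (\<lambda>g. g)"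
proof -
  interpret surjective_family UNIV G "\<lambda>g. g"
    by unfold_locales (auto simp: finite aut bij_is_surj)
  show ?thesis
    using invariants_sum_orbit id_closed
    by unfold_locales (auto simp: trace_def invariants_def)
qed

text \<open>Traces are invariants, so they inherit the nilpotency. This is applied to
  \<open>N(p)\<close> acting on the whole ring.\<close>

lemma products_if_trace_nilpotent:
  assumes "products_in (invariants G) d {0}" "d \<ge> 1"
  shows "products_in (UNIV :: 'a set) (h_bound (Aut_subgroup G) ^ d) (pure_closure (card G) {0})"
proof -
  interpret invariant_trace_family UNIV G "\<lambda>g. g" by (rule invariant_trace_family)
  have "trace ` UNIV \<subseteq> invariants G"
    using invariants_sum_orbit by (auto simp: trace_def)
  then have "products_in (trace ` UNIV) d {0}"
    using assms(1) products_in_mono by blast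
  then show ?thesis
    using products_pure_closure_zero[OF assms(2)] by (simp add: h_bound_def order_def)
qed

end

section \<open>The action of a quotient on the invariants of a normal subgroup\<close>

locale normal_aut_group = finite_aut_group +
  fixes N :: "('a \<Rightarrow> 'a) set"
  assumes normal: "N \<lhd> Aut_subgroup G"
begin

sublocale N: normal N "Aut_subgroup G" by (rule normal)

lemma subgroup_normal: "subgroup N ring_Aut"
  using group.incl_subgroup[OF group_ring_Aut subgroup N.is_subgroup] .

lemma normal_subset: "N \<subseteq> G"
  using N.subset by simp

sublocale N: finite_aut_group N
  using subgroup_normal finite_subset[OF normal_subset finite] by (rule finite_aut_group.intro)

abbreviation "Q \<equiv> Aut_subgroup G Mod N"

sublocale Q: group Q
  by (rule N.factorgroup_is_group)

lemma invariantsD: "r \<in> invariants N \<Longrightarrow> g \<in> N \<Longrightarrow> g r = r"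
  by (simp add: invariants_def)

text \<open>By normality \<open>n \<circ> g = g \<circ> n'\<close> for some \<open>n'\<close> in
  \<open>N\<close>.\<close>

lemma invariants_closed:
  assumes "g \<in> G" "r \<in> invariants N"
  shows "g r \<in> invariants N"
proof -
  have "n (g r) = g r" if "n \<in> N" for n
  proof -
    have "n \<circ> g \<in> N #>\<^bsub>Aut_subgroup G\<^esub> g"
      using that by (auto simp: r_coset_def ring_Aut_def)
    also have "\<dots> = g <#\<^bsub>Aut_subgroup G\<^esub> N"
      using N.coset_eq assms(1) by simp
    finally obtain n' where "n' \<in> N" "\<And>x. n (g x) = g (n' x)"
      by (auto simp: l_coset_def ring_Aut_def fun_eq_iff)
    then show ?thesis
      using assms(2) invariantsD by metis
  qed
  then show ?thesis by (simp add: invariants_def)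
qed

lemma coset_rep:
  assumes "C \<in> carrier Q"
  obtains g where "g \<in> G" "g \<in> C" "\<And>r. r \<in> invariants N \<Longrightarrow> coset_act C r = g r"
proof -
  obtain g where g: "g \<in> G" "C = N #>\<^bsub>Aut_subgroup G\<^esub> g"
    using assms by (auto simp: carrier_FactGroup)
  then have "g \<in> C" using rcos_self[of g N] N.is_subgroup by simp
  then show ?thesis
    using that[OF g(1)] coset_act_eq[OF normal assms] by blast
qed

lemma coset_act_mult:
  assumes "D \<in> carrier Q" "C \<in> carrier Q" "r \<in> invariants N"
  shows "coset_act (D \<otimes>\<^bsub>Q\<^esub> C) r = coset_act D (coset_act C r)"
proof -
  obtain g where g: "g \<in> D" "\<And>r. r \<in> invariants N \<Longrightarrow> coset_act D r = g r"
    using coset_rep[OF assms(1)] by metis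
  obtain h where h: "h \<in> G" "h \<in> C" "coset_act C r = h r"
    using coset_rep[OF assms(2)] assms(3) by metis
  have "g \<circ> h \<in> D \<otimes>\<^bsub>Q\<^esub> C"
    using g(1) h(2) by (auto simp: set_mult_def ring_Aut_def)
  then have "coset_act (D \<otimes>\<^bsub>Q\<^esub> C) r = (g \<circ> h) r"
    using coset_act_eq[OF normal Q.m_closed[OF assms(1,2)] _ assms(3)] by blast
  then show ?thesis
    using g(2) h invariants_closed assms(3) by simp
qed

lemma invariants_ring:
  shows "0 \<in> invariants N"
    and "x \<in> invariants N \<Longrightarrow> y \<in> invariants N \<Longrightarrow> x - y \<in> invariants N"
    and "x \<in> invariants N \<Longrightarrow> y \<in> invariants N \<Longrightarrow> x + y \<in> invariants N"
    and "x \<in> invariants N \<Longrightarrow> y \<in> invariants N \<Longrightarrow> x * y \<in> invariants N"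
  using N.aut_zero N.aut_diff N.aut(2,3) unfolding invariants_def mem_Collect_eq by metis+

lemma invariants_nat_multiple: "x \<in> invariants N \<Longrightarrow> nat_multiple k x \<in> invariants N"
  using N.aut_nat_multiple unfolding invariants_def mem_Collect_eq by metis

lemma invariants_sum: "(\<And>i. i \<in> B \<Longrightarrow> f i \<in> invariants N) \<Longrightarrow> sum f B \<in> invariants N"
  by (induction B rule: infinite_finite_induct) (auto intro: invariants_ring)

lemma finite_quotient: "finite (carrier Q)"
  using finite by (simp add: carrier_FactGroup)

lemma surjective_family_quotient: "surjective_family (invariants N) (carrier Q) coset_act"
proof
  fix C assume C: "C \<in> carrier Q"
  obtain g where g: "g \<in> G" "\<And>r. r \<in> invariants N \<Longrightarrow> coset_act C r = g r"
    using coset_rep[OF C] by metis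
  obtain h where h: "h \<in> G" "g \<circ> h = id" using inverse_closed[OF g(1)] by blast
  have "x \<in> g ` invariants N" if "x \<in> invariants N" for x
    using inverse_eq[OF h(2), of x] invariants_closed[OF h(1) that] by (metis imageI)
  then show "coset_act C ` invariants N = invariants N"
    using g invariants_closed by auto
  fix x y :: 'a assume xy: "x \<in> invariants N" "y \<in> invariants N"
  show "coset_act C (x + y) = coset_act C x + coset_act C y"
    "coset_act C (x * y) = coset_act C x * coset_act C y"
    using g(2)[OF invariants_ring(3)[OF xy]] g(2)[OF invariants_ring(4)[OF xy]] g(2)[OF xy(1)] g(2)[OF xy(2)]
    by (simp_all add: aut[OF g(1)])
qed (auto simp: invariants_ring finite_quotient)

text \<open>Since \<open>coset_act\<close> is an action, applying a coset permutes the summands of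
  the trace.\<close>

lemma quotient_trace_family:
  "invariant_trace_family (invariants N) (carrier Q) coset_act"
proof -
  interpret surjective_family "invariants N" "carrier Q" coset_act
    by (rule surjective_family_quotient)
  show ?thesis
  proof
    show "carrier Q \<noteq> {}" using Q.one_closed by blast
    fix D r assume D: "D \<in> carrier Q" and r: "r \<in> invariants N"
    obtain g where g: "g \<in> G" "\<And>r. r \<in> invariants N \<Longrightarrow> coset_act D r = g r"
      using coset_rep[OF D] by metis
    have "coset_act D (trace r) = (\<Sum>C\<in>carrier Q. coset_act D (coset_act C r))"
      using g trace_closed[OF r] hom_closed[OF _ r] by (simp add: trace_def aut_sum)
    also have "\<dots> = (\<Sum>C\<in>carrier Q. coset_act (D \<otimes>\<^bsub>Q\<^esub> C) r)"
      using D r by (intro sum.cong) (simp_all add: coset_act_mult del: mult_FactGroup)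
    also have "\<dots> = (\<Sum>C\<in>carrier Q. coset_act C r)"
      using Q.inj_on_cmult[OF D] Q.surj_const_mult[OF D]
      by (intro sum.reindex_bij_betw[of "\<lambda>C. D \<otimes>\<^bsub>Q\<^esub> C"]) (simp add: bij_betw_def)
    finally show "coset_act D (trace r) = trace r" by (simp add: trace_def)
  qed
qed

section \<open>Counting cosets and orbits\<close>

lemma order_quotient: "card (carrier Q) * card N = card G"
  using lagrange[OF N.is_subgroup] by (simp add: FactGroup_def order_def)

text \<open>The stabilizer contains \<open>N\<close>, so the length of the orbit divides
  \<open>p ^ s\<close>; it is not \<open>1\<close> because \<open>z\<close> is not fixed.\<close>

lemma dvd_card_orbit:
  assumes "prime p" "card G = p ^ s * card N" "z \<in> invariants N" "z \<notin> invariants G"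
  shows "p dvd card ((\<lambda>g. g z) ` G)"
proof -
  define Stab where "Stab = {g \<in> G. g z = z}"
  let ?O = "(\<lambda>g. g z) ` G"
  \<comment> \<open>The fibres of the orbit map are the left cosets of the stabilizer.\<close>
  have "card {g \<in> G. g z = w} = card Stab" if w: "w \<in> ?O" for w
  proof -
    obtain g where g: "g \<in> G" "w = g z" using w by blast
    obtain h where h: "h \<in> G" "h \<circ> g = id" "g \<circ> h = id" using inverse_closed[OF g(1)] by blast
    have "h (g x) = x" "g (h x) = x" for x
      using h(2,3) by (metis comp_apply id_apply)+
    then have "bij_betw ((\<circ>) g) Stab {g \<in> G. g z = w}"
      using g h(1) by (intro bij_betw_byWitness[where f' = "(\<circ>) h"])
        (auto simp: Stab_def fun_eq_iff intro: comp_closed)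
    then show ?thesis by (simp add: bij_betw_same_card)
  qed
  then have "card G = card ?O * card Stab"
    using sum.image_gen[OF finite, of "\<lambda>_. 1 :: nat" "\<lambda>g. g z"] by simp
  moreover have "card N dvd card Stab"
  proof -
    have "subgroup Stab (Aut_subgroup G)"
    proof
      fix g assume "g \<in> Stab"
      then have g: "g \<in> G" "g z = z" by (auto simp: Stab_def)
      then have inv: "inv\<^bsub>Aut_subgroup G\<^esub> g \<in> G" "inv\<^bsub>Aut_subgroup G\<^esub> g \<circ> g = id"
        using inv_closed[of g] l_inv[of g] by (auto simp: ring_Aut_def)
      then have "(inv\<^bsub>Aut_subgroup G\<^esub> g) z = z"
        using g(2) by (metis comp_apply id_apply)
      then show "inv\<^bsub>Aut_subgroup G\<^esub> g \<in> Stab" using inv by (simp add: Stab_def)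
    qed (auto simp: Stab_def ring_Aut_def id_closed comp_closed)
    then interpret Stab: subgroup Stab "Aut_subgroup G" .
    have "N \<subseteq> Stab"
      using normal_subset invariantsD[OF assms(3)] by (auto simp: Stab_def)
    then have "subgroup N (Aut_subgroup G\<lparr>carrier := Stab\<rparr>)"
      using subgroup_incl[OF N.is_subgroup Stab.subgroup_axioms] by blast
    from group.lagrange[OF Stab.subgroup_is_group[OF is_group] this]
    have "card Stab = card (rcosets\<^bsub>Aut_subgroup G\<lparr>carrier := Stab\<rparr>\<^esub> N) * card N"
      by (simp add: order_def)
    then show ?thesis by (rule dvdI[OF trans[OF _ mult.commute]])
  qed
  then obtain q where "card Stab = card N * q" by blast
  moreover have "card N > 0"
    using N.id_closed N.finite card_gt_0_iff by blast
  ultimately have "card ?O * q = p ^ s" using assms(2) by simp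
  then obtain i where i: "card ?O = p ^ i"
    using assms(1) by (metis divides_primepow_nat dvd_triv_left)
  have "i \<noteq> 0"
  proof
    assume "i = 0"
    then obtain w where "?O = {w}" using i card_1_singletonE by auto
    then have orbit: "g z = w" if "g \<in> G" for g using imageI[OF that, of "\<lambda>g. g z"] by simp
    then have "g z = z" if "g \<in> G" for g using that id_closed by (metis id_apply)
    then show False using assms(4) by (simp add: invariants_def)
  qed
  then show ?thesis using i by (simp add: dvd_power)
qed

text \<open>The points that are not fixed fall into disjoint orbits of length divisible by
  \<open>p\<close>.\<close>

lemma dvd_card_fixed_points:
  assumes "prime p" "card G = p ^ s * card N"
    and M: "finite M" "M \<subseteq> invariants N" "\<And>g z. g \<in> G \<Longrightarrow> z \<in> M \<Longrightarrow> g z \<in> M" "p dvd card M"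
  shows "p dvd card (M \<inter> invariants G)"
proof -
  let ?R = "M - invariants G" and ?orbit = "\<lambda>z. (\<lambda>g. g z) ` G"
  have Union_orbits: "\<Union>(?orbit ` ?R) = ?R"
  proof
    have "z \<in> ?orbit z" for z
      using id_closed by (intro image_eqI[of _ _ id]) simp_all
    then show "?R \<subseteq> \<Union>(?orbit ` ?R)" by blast
    \<comment> \<open>An orbit through a fixed point consists of that point, so orbits of other
      points contain no fixed point.\<close>
    have "z \<in> invariants G" if "g \<in> G" "g z \<in> invariants G" for g z
    proof -
      obtain h where h: "h \<in> G" "h \<circ> g = id" using inverse_closed[OF \<open>g \<in> G\<close>] by blast
      then have "z = h (g z)" using inverse_eq by metis
      also have "\<dots> = g z" using that(2) h(1) by (simp add: invariants_def)
      finally show ?thesis using that(2) by simp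
    qed
    then show "\<Union>(?orbit ` ?R) \<subseteq> ?R" using M(3) by blast
  qed
  have orbits_eq: "?orbit y = ?orbit z" if w: "w \<in> ?orbit y" "w \<in> ?orbit z" for w y z
  proof -
    have orbit_eq: "?orbit (g x) = ?orbit x" if g: "g \<in> G" for g x
    proof -
      obtain h where h: "h \<in> G" "h \<circ> g = id" using inverse_closed[OF g] by blast
      have "f x \<in> ?orbit (g x)" if "f \<in> G" for f
        using comp_closed[OF that h(1)] inverse_eq[OF h(2)] by (intro image_eqI[of _ _ "f \<circ> h"]) auto
      moreover have "f (g x) \<in> ?orbit x" if "f \<in> G" for f
        using comp_closed[OF that g] by (intro image_eqI[of _ _ "f \<circ> g"]) auto
      ultimately show ?thesis by blast
    qed
    obtain g h where "g \<in> G" "w = g y" "h \<in> G" "w = h z" using w by blast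
    then show ?thesis using orbit_eq[of g y] orbit_eq[of h z] by simp
  qed
  have "pairwise disjnt (?orbit ` ?R)"
  proof (intro pairwiseI, elim imageE)
    fix A B y z assume "A \<noteq> B" "A = ?orbit y" "B = ?orbit z"
    then show "disjnt A B" using orbits_eq[of _ y z] unfolding disjnt_iff by metis
  qed
  then have "card ?R = sum card (?orbit ` ?R)"
    using finite card_Union_disjoint[of "?orbit ` ?R"] Union_orbits by auto
  moreover have "p dvd sum card (?orbit ` ?R)"
    using M(2) dvd_card_orbit[OF assms(1,2)] by (intro dvd_sum) blast
  ultimately have "p dvd card ?R" by simp
  moreover have "card M = card (M \<inter> invariants G) + card ?R"
    using M(1) by (metis Int_Diff_Un Int_Diff_disjoint card_Un_disjoint finite_Diff finite_Int)
  ultimately show ?thesis using M(4) by (simp add: dvd_add_left_iff)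
qed

end

text \<open>Lagrange's theorem for the additive group on \<open>M\<close>, in which \<open>y\<close>
  has order \<open>p\<close>.\<close>

lemma prime_dvd_card_additive_subgroup:
  assumes p: "prime p" and M: "finite M" "0 \<in> M" "\<And>x y. x \<in> M \<Longrightarrow> y \<in> M \<Longrightarrow> x - y \<in> M"
    and y: "y \<in> M" "y \<noteq> 0" "nat_multiple p y = (0::'a::ring)"
  shows "p dvd card M"
proof -
  let ?M = "\<lparr>carrier = M, monoid.mult = (+), one = 0 :: 'a\<rparr>"
  have add: "x + z \<in> M" if "x \<in> M" "z \<in> M" for x z
    using M(3)[OF that(1) M(3)[OF M(2) that(2)]] by simp
  interpret M: group ?M
  proof (rule groupI)
    fix x assume "x \<in> carrier ?M"
    then show "\<exists>z\<in>carrier ?M. z \<otimes>\<^bsub>?M\<^esub> x = \<one>\<^bsub>?M\<^esub>"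
      using M(3)[OF M(2)] by (intro bexI[of _ "- x"]) auto
  qed (auto simp: M(2) add add.assoc)
  have "y [^]\<^bsub>?M\<^esub> k = nat_multiple k y" for k :: nat
    by (induction k) (simp_all add: nat_multiple_Suc)
  then have "M.ord y dvd p" "M.ord y \<noteq> 1"
    using M.pow_eq_id[of y p] M.ord_eq_1[of y] y by auto
  then have "M.ord y = p" using p by (metis prime_nat_iff)
  then show ?thesis
    using M.ord_dvd_group_order[of y] y(1) by (simp add: order_def)
qed

section \<open>Torsion and nilpotency of the invariants of \<open>N\<close>\<close>

context normal_aut_group
begin

text \<open>The orbit of \<open>y\<close> generates a finite additive group \<open>M\<close> killed
  by \<open>p\<close>. Both \<open>card M\<close> and the number of its fixed points are multiples
  of \<open>p\<close>, and \<open>0\<close> is fixed, so a nonzero point is fixed too.\<close>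

lemma ex_invariant_of_prime_torsion:
  assumes p: "prime p" "card G = p ^ s * card N"
    and y: "y \<in> invariants N" "y \<noteq> 0" "nat_multiple p y = 0"
  obtains z where "z \<in> invariants G" "z \<noteq> 0" "nat_multiple p z = 0"
proof -
  define c where "c k = (\<Sum>g\<in>G. nat_multiple (k g) (g y))" for k
  define M where "M = range c"
  have torsion: "nat_multiple p (g y) = 0" if "g \<in> G" for g
    using aut_nat_multiple[OF that, of p y] aut_zero[OF that] y(3) by simp
  \<comment> \<open>Coefficients matter only modulo \<open>p\<close>, which makes \<open>M\<close>
    finite.\<close>
  have "c k \<in> c ` (G \<rightarrow>\<^sub>E {..<p})" for k
  proof -
    have "c k = c (\<lambda>g\<in>G. k g mod p)"
      unfolding c_def using torsion by (intro sum.cong) (auto simp: nat_multiple_mod)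
    moreover have "(\<lambda>g\<in>G. k g mod p) \<in> G \<rightarrow>\<^sub>E {..<p}"
      using prime_gt_0_nat[OF p(1)] by auto
    ultimately show ?thesis by blast
  qed
  then have "finite M"
    using finite finite_subset[of M "c ` (G \<rightarrow>\<^sub>E {..<p})"] by (auto simp: M_def intro: finite_PiE)
  \<comment> \<open>On elements killed by \<open>p\<close>, the coefficient \<open>p - 1\<close>
    acts as \<open>-1\<close>, so natural coefficients suffice for differences.\<close>
  have c_diff: "c k - c l = c (\<lambda>g. k g + (p - 1) * l g)" for k l
  proof -
    have "nat_multiple ((p - 1) * l g) (g y) + nat_multiple (l g) (g y) = 0" if "g \<in> G" for g
    proof -
      have "(p - 1) * l g + l g = l g * p"
        using prime_gt_0_nat[OF p(1)] by (simp add: algebra_simps)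
      then show ?thesis
        using torsion[OF that] by (metis nat_multiple_add nat_multiple_mult nat_multiple_zero)
    qed
    then have "nat_multiple ((p - 1) * l g) (g y) = - nat_multiple (l g) (g y)" if "g \<in> G" for g
      using that by (simp add: eq_neg_iff_add_eq_0)
    then show ?thesis
      by (simp add: c_def nat_multiple_add sum.distrib sum_negf sum_subtractf)
  qed
  have c_act: "h (c k) \<in> M" if h: "h \<in> G" for h k
  proof -
    obtain h' where h': "h' \<in> G" "h' \<circ> h = id" using inverse_closed[OF h] by blast
    have "h (c k) = (\<Sum>g\<in>G. nat_multiple (k g) ((h \<circ> g) y))"
      using h by (simp add: c_def aut_sum aut_nat_multiple)
    \<comment> \<open>Inserting \<open>h' \<circ> h = id\<close> makes the summand a function of
      \<open>h \<circ> g\<close>, ready for reindexing by translation.\<close>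
    also have "\<dots> = (\<Sum>g\<in>G. nat_multiple (k (h' \<circ> (h \<circ> g))) ((h \<circ> g) y))"
      using h'(2) by (simp flip: comp_assoc)
    also have "\<dots> = (\<Sum>g\<in>G. nat_multiple (k (h' \<circ> g)) (g y))"
      by (rule sum.reindex_bij_betw[OF bij_betw_comp[OF h], of "\<lambda>g. nat_multiple (k (h' \<circ> g)) (g y)"])
    also have "\<dots> = c (\<lambda>g. k (h' \<circ> g))" by (simp add: c_def)
    finally show ?thesis by (simp add: M_def)
  qed
  have "c (\<lambda>g. if g = id then 1 else 0) = (\<Sum>g\<in>G. if g = id then y else 0)"
    unfolding c_def by (intro sum.cong) auto
  then have c_y: "y = c (\<lambda>g. if g = id then 1 else 0)"
    using finite id_closed by simp
  have c_0: "0 = c (\<lambda>_. 0)" by (simp add: c_def)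
  have M_diff: "x - z \<in> M" if "x \<in> M" "z \<in> M" for x z
    using that c_diff by (auto simp: M_def)
  have "0 \<in> M" "y \<in> M" unfolding M_def using c_0 c_y by blast+
  have "p dvd card M"
    using p(1) \<open>finite M\<close> \<open>0 \<in> M\<close> M_diff \<open>y \<in> M\<close> y(2,3) by (rule prime_dvd_card_additive_subgroup)
  moreover have "M \<subseteq> invariants N"
    using invariants_closed y(1) by (auto simp: M_def c_def intro!: invariants_sum invariants_nat_multiple)
  ultimately have "p dvd card (M \<inter> invariants G)"
    using c_act \<open>finite M\<close> by (intro dvd_card_fixed_points[OF p]) (auto simp: M_def)
  moreover have "0 \<in> M \<inter> invariants G"
    using \<open>0 \<in> M\<close> aut_zero by (simp add: invariants_def)
  ultimately have "M \<inter> invariants G \<noteq> {0}"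
    using prime_gt_1_nat[OF p(1)] by (metis card.empty card_insert_disjoint empty_iff finite.emptyI
      nat_dvd_1_iff_1 less_irrefl One_nat_def)
  then obtain z where z: "z \<in> M" "z \<in> invariants G" "z \<noteq> 0"
    using \<open>0 \<in> M \<inter> invariants G\<close> by blast
  moreover have "nat_multiple p z = 0"
  proof -
    obtain k where k: "z = c k" using z(1) by (auto simp: M_def)
    have "nat_multiple p (nat_multiple (k g) (g y)) = 0" if "g \<in> G" for g
      using torsion[OF that] by (metis nat_multiple_mult mult.commute nat_multiple_zero)
    moreover have "additive (nat_multiple p :: 'a \<Rightarrow> 'a)"
      by (simp add: additive_def nat_multiple_add_right)
    ultimately show ?thesis by (simp add: k c_def additive.sum)
  qed
  ultimately show ?thesis using that by blast
qed

text \<open>The exponent is lowered one \<open>p\<close> at a time; a nonzero \<open>x\<close>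
  killed by \<open>p\<close> itself would yield such an element fixed by \<open>G\<close>.\<close>

lemma invariants_torsion_free:
  assumes p: "prime p" "card G = p ^ s * card N" and "torsion_free p (invariants G)"
  shows "torsion_free p (invariants N)"
proof -
  have "x = 0" if x: "x \<in> invariants N" "nat_multiple (p ^ i) x = 0" for x i
    using x
  proof (induction i arbitrary: x)
    case (Suc i)
    have "nat_multiple p x \<in> invariants N"
      using Suc.prems(1) by (rule invariants_nat_multiple)
    then have "nat_multiple p x = 0"
      using Suc by (metis nat_multiple_mult power_Suc2)
    then show ?case
      using ex_invariant_of_prime_torsion[OF p Suc.prems(1)] torsion_freeD[OF assms(3), of _ 1]
      by (metis power_one_right)
  qed simp
  then show ?thesis
    using invariants_ring(1) by (auto simp: torsion_free_def tor_def intro: exI[of _ 1])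
qed

text \<open>The quotient has order \<open>p ^ s\<close>, so the products are killed by powers of
  \<open>p\<close> and vanish by torsion-freeness.\<close>

lemma products_invariants:
  assumes "prime p" "card G = p ^ s * card N" "torsion_free p (invariants G)"
    and "d \<ge> 1" "products_in (quotient_trace G N ` invariants N) d {0}"
  shows "products_in (invariants N) (h_bound Q ^ d) {0}"
proof -
  interpret invariant_trace_family "invariants N" "carrier Q" coset_act
    by (rule quotient_trace_family)
  have "trace = quotient_trace G N"
    by (intro ext) (simp add: trace_def quotient_trace_def)
  then have pure: "products_in (invariants N) (h_bound Q ^ d) (pure_closure (card (carrier Q)) {0})"
    using products_pure_closure_zero[OF assms(4)] assms(5) by (simp add: h_bound_def order_def)
  have "card N > 0"
    using N.id_closed N.finite card_gt_0_iff by blast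
  then have card_Q: "card (carrier Q) = p ^ s"
    using order_quotient assms(2) by simp
  have "h_bound Q \<noteq> 0" by (simp add: h_bound_def prod_zero_iff)
  have closed: "list_product xs \<in> invariants N" if "set xs \<subseteq> invariants N" "xs \<noteq> []" for xs
    using that by (induction xs rule: list_product.induct) (auto intro: invariants_ring)
  show ?thesis
    unfolding products_in_def
  proof (intro allI impI, elim conjE)
    fix xs assume xs: "set xs \<subseteq> invariants N" "length xs = h_bound Q ^ d"
    then have "list_product xs \<in> invariants N"
      using closed \<open>h_bound Q \<noteq> 0\<close> by (metis list.size(3) power_not_zero)
    moreover obtain e where "nat_multiple ((p ^ s) ^ e) (list_product xs) = 0"
      using products_inD[OF pure xs] card_Q by (metis pure_closure_zero)
    ultimately show "list_product xs \<in> {0}"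
      using torsion_freeD[OF invariants_torsion_free[OF assms(1-3)]] by (simp flip: power_mult)
  qed
qed

end

section \<open>Combination over all bad primes\<close>

theorem theorem1p3:
  fixes G :: "('a::ring \<Rightarrow> 'a) set"
    and N :: "nat \<Rightarrow> ('a \<Rightarrow> 'a) set"
    and d :: "nat \<Rightarrow> nat"
  assumes "subgroup G (ring_Aut :: ('a \<Rightarrow> 'a) monoid)" and "finite G"
    and "bad_primes G \<noteq> {}"
    and "\<And>p. p \<in> bad_primes G \<Longrightarrow> normal_complement p (N p) (Aut_subgroup G)"
    and "\<And>p. p \<in> bad_primes G \<Longrightarrow> torsion_free p (invariants G)"
    and "\<And>p. p \<in> bad_primes G \<Longrightarrow>
           d p \<ge> 1 \<and> power_zero (quotient_trace G (N p) ` invariants (N p)) (d p)"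
  shows "power_zero (UNIV :: 'a set)
           (Max ((\<lambda>p. h_bound (Aut_subgroup (N p)) ^ (h_bound (Aut_subgroup G Mod N p) ^ d p)) ` bad_primes G))
       \<and> nilpotent (UNIV :: 'a set)
       \<and> (\<forall>p\<in>bad_primes G.
            torsion_free p (invariants (N p))
          \<and> nilpotent (invariants (N p))
          \<and> power_zero (invariants (N p)) (h_bound (Aut_subgroup G Mod N p) ^ d p))"
proof -
  let ?B = "bad_primes G"
  define m where "m p = h_bound (Aut_subgroup G Mod N p) ^ d p" for p
  define l where "l p = h_bound (Aut_subgroup (N p)) ^ m p" for p
  interpret finite_aut_group G
    using assms(1,2) by (rule finite_aut_group.intro)
  have prime: "prime p" if "p \<in> ?B" for p
    using that by (simp add: bad_primes_def)
  have normal: "normal_aut_group G (N p)" if "p \<in> ?B" for p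
    using assms(4)[OF that] finite_aut_group_axioms
    by (intro normal_aut_group.intro normal_aut_group_axioms.intro) (simp_all add: normal_complement_def)
  have card_G: "\<exists>s. card G = p ^ s * card (N p)" and p_card: "\<not> p dvd card (N p)" if "p \<in> ?B" for p
    using assms(4)[OF that] by (auto simp: normal_complement_def order_def)
  have h_pos: "h_bound H \<ge> 1" for H :: "('g, 'x) monoid_scheme"
    by (simp add: h_bound_def Suc_le_eq prod_pos)
  have l_pos: "l p \<ge> 1" and m_pos: "m p \<ge> 1" for p
    by (simp_all only: l_def m_def one_le_power h_pos)
  have torsion: "torsion_free p (invariants (N p))" if p: "p \<in> ?B" for p
    using card_G[OF p] normal_aut_group.invariants_torsion_free[OF normal[OF p] prime[OF p] _ assms(5)[OF p]] by blast
  have products: "products_in (invariants (N p)) (m p) {0}" if p: "p \<in> ?B" for p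
    using card_G[OF p] normal_aut_group.products_invariants[OF normal[OF p] prime[OF p] _ assms(5)[OF p], of _ "d p"]
      assms(6)[OF p] by (auto simp: power_zero_iff m_def)
  have pure: "products_in (UNIV :: 'a set) (l p) (pure_closure (card (N p)) {0})" if p: "p \<in> ?B" for p
  proof -
    interpret normal_aut_group G "N p" by (rule normal[OF p])
    \<comment> \<open>The exponent \<open>m p\<close> just obtained for the invariants of
      \<open>N p\<close> serves as the trace exponent for \<open>N p\<close> acting on the
      ring.\<close>
    show ?thesis
      using N.products_if_trace_nilpotent[OF products[OF p] m_pos] by (simp add: l_def)
  qed
  define L where "L = Max (l ` ?B)"
  \<comment> \<open>Bad primes divide \<open>card G\<close>, so the maximum is taken over a finite
    set.\<close>
  have "?B \<subseteq> {p. p dvd card G}" by (auto simp: bad_primes_def)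
  moreover have "card G > 0" using id_closed finite card_gt_0_iff by blast
  ultimately have "finite ?B" by (intro finite_subset[OF _ finite_divisors_nat])
  then have l_le: "l p \<le> L" if "p \<in> ?B" for p using that by (simp add: L_def)
  obtain p where p: "p \<in> ?B" using assms(3) by blast
  have "x = 0" if "set xs \<subseteq> UNIV" "length xs = L" and x: "x = list_product xs" for x and xs :: "'a list"
  proof (rule ccontr)
    \<comment> \<open>All bad primes are used for the same \<open>x\<close>, which is why the
      exponent is the maximum \<open>L\<close>.\<close>
    have annihilated: "\<exists>e. nat_multiple (card (N q) ^ e) x = 0" if q: "q \<in> ?B" for q
    proof -
      have "y * z \<in> pure_closure (card (N q)) {0}" if "y \<in> pure_closure (card (N q)) {0}" for y z :: 'a
        using pure_closure_map[where f = "\<lambda>y. y * z", OF _ _ that]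
        by (auto simp: additive_def distrib_right intro: pure_closure.zero)
      then have "products_in (UNIV :: 'a set) L (pure_closure (card (N q)) {0})"
        using products_in_zero_mono[OF _ l_pos pure[OF q] l_le[OF q]] by blast
      then have "x \<in> pure_closure (card (N q)) {0}"
        using \<open>length xs = L\<close> x by (simp add: products_in_def)
      then show ?thesis by (metis pure_closure_zero)
    qed
    assume "x \<noteq> 0"
    obtain e where e: "nat_multiple (card (N p) ^ e) x = 0" using annihilated[OF p] by blast
    have "card (N p) \<noteq> 0" using p_card[OF p] by (metis dvd_0_right)
    then have "card (N p) ^ e > 0" by simp
    then obtain q and z :: 'a where q: "prime q" and z: "z \<noteq> 0" "nat_multiple q z = 0"
      and q_dvd: "\<And>k. nat_multiple k x = 0 \<Longrightarrow> q dvd k"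
      by (rule nat_multiple_prime_annihilator[OF \<open>x \<noteq> 0\<close> e]) blast
    have q_card: "q dvd card (N r)" if "r \<in> ?B" for r
      using annihilated[OF that] q_dvd q prime_dvd_power_nat by blast
    then have "q dvd card G" using card_G[OF p] p by auto
    moreover have "tor q (UNIV :: 'a set) \<noteq> {0}"
    proof
      assume "tor q (UNIV :: 'a set) = {0}"
      then show False using torsion_freeD[of q UNIV z 1] z by (simp add: torsion_free_def)
    qed
    \<comment> \<open>Being bad, \<open>q\<close> may now be taken as the index: it divides the
      order of its own complement \<open>N q\<close>, which is prime to \<open>q\<close>.\<close>
    ultimately have "q \<in> ?B" using q by (simp add: bad_primes_def)
    then show False using q_card p_card by blast
  qed
  then have "products_in (UNIV :: 'a set) L {0}" by (auto simp: products_in_def)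
  moreover have "L \<ge> 1" using l_le[OF p] l_pos[of p] by simp
  ultimately have "power_zero (UNIV :: 'a set) L" by (simp add: power_zero_iff)
  moreover have "power_zero (invariants (N p)) (m p)" if "p \<in> ?B" for p
    using products[OF that] m_pos by (simp add: power_zero_iff)
  ultimately show ?thesis
    using torsion unfolding nilpotent_def L_def l_def m_def by blast
qed

end
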